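(* For every fair division instance $\mathcal{I}=(N,M,\mathcal{V})$ in which all agents have additive valuations, and every real number $\alpha \le \frac{3}{4}+\frac{3}{3836}$, there exists an $\alpha$-MMS allocation of $\mathcal{I}$.
   Context: A fair division instance $\mathcal{I}=(N,M,\mathcal{V})$ consists of a set of agents $N=[n]$, a finite set $M$ of indivisible goods, and valuations $v_i:2^M\to\mathbb{R}_{\ge 0}$ for $i\in N$, which are additive: $v_i(S)=\sum_{g\in S}v_i(\{g\})$. For a valuation $v$, a set $S$ of goods and an integer $d\ge 1$, $\mathrm{MMS}^d_v(S)=\max_{(P_1,\dots,P_d)}\min_{j\in[d]}v(P_j)$, where the maximum ranges over all partitions of $S$ into $d$ (possibly empty) bundles. The maximin share of agent $i$ is $\mathrm{MMS}_i=\mathrm{MMS}^n_{v_i}(M)$. An allocation assigns to each agent $i$ a bundle $A_i\subseteq M$, the bundles being pairwise disjoint; it is $\alpha$-MMS if $v_i(A_i)\ge \alpha\cdot \mathrm{MMS}_i$ for every agent $i\in N$. *)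

theory Defs
  imports Complex_Main
begin

text \<open>Goods have type 'g; M is a finite set of goods. An additive valuation is given by
  its values on single goods, v :: 'g \<Rightarrow> real (nonnegative); the value of a bundle S is
  the sum of v over S.\<close>

definition additive_val :: "('g \<Rightarrow> real) \<Rightarrow> 'g set \<Rightarrow> real" where
  "additive_val v S = (\<Sum>g\<in>S. v g)"

definition partitions :: "nat \<Rightarrow> 'g set \<Rightarrow> (nat \<Rightarrow> 'g set) set" where
  "partitions d S = {P. (\<forall>j. j \<ge> d \<longrightarrow> P j = {}) \<and>
                        (\<Union>j<d. P j) = S \<and>
                        (\<forall>j<d. \<forall>k<d. j \<noteq> k \<longrightarrow> P j \<inter> P k = {})}"

definition MMS :: "nat \<Rightarrow> ('g \<Rightarrow> real) \<Rightarrow> 'g set \<Rightarrow> real" where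
  "MMS d v S = Max ((\<lambda>P. Min ((\<lambda>j. additive_val v (P j)) ` {..<d})) ` partitions d S)"

definition is_allocation :: "nat \<Rightarrow> 'g set \<Rightarrow> (nat \<Rightarrow> 'g set) \<Rightarrow> bool" where
  "is_allocation n M A \<longleftrightarrow> (\<forall>i<n. A i \<subseteq> M) \<and>
                            (\<forall>i<n. \<forall>k<n. i \<noteq> k \<longrightarrow> A i \<inter> A k = {})"

definition alpha_MMS :: "real \<Rightarrow> nat \<Rightarrow> 'g set \<Rightarrow> (nat \<Rightarrow> 'g \<Rightarrow> real) \<Rightarrow> (nat \<Rightarrow> 'g set) \<Rightarrow> bool" where
  "alpha_MMS \<alpha> n M v A \<longleftrightarrow> is_allocation n M A \<and>
     (\<forall>i<n. additive_val (v i) (A i) \<ge> \<alpha> * MMS n (v i) M)"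

end

theory Submission
  imports Defs "HOL-Library.Infinite_Set" "HOL-Library.Disjoint_Sets"
begin

text \<open>
  Sort the goods by value, so that all agents agree on the order, and scale every maximin share to
  1. Let \<open>0 \<le> \<delta> \<le> 3/3836\<close>. As long as one of the sets \<open>{j(n-1)..jn}\<close> with \<open>j \<le> 3\<close> or \<open>{0, 2n}\<close>
  (counting goods from 0) is worth \<open>3/4 + \<delta>\<close> to somebody, she leaves with it. The maximin shares
  of the others never drop below \<open>1 - 4\<delta>\<close>, so after rescaling we are left with an instance in
  which none of these sets is worth \<open>3/4 + d\<close> to anybody, where \<open>d = 4\<delta>/(1-4\<delta>) \<le> 3/956\<close>.

  Such an instance is solved by bag filling: the top \<open>2n\<close> goods are paired to \<open>n\<close> bags, and bag
  after bag is filled with the remaining goods until somebody values it at \<open>3/4 + d\<close>. If good \<open>2n\<close>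
  is worth at most \<open>1/4 - d\<close> to an agent, a filled bag is worth at most 1 to her; call the other
  agents tight. If at least a quarter of the agents are not tight, pair \<open>k\<close> with \<open>2n-1-k\<close> and
  prefer tight agents: a tight agent who got nothing has seen so many bags far below 1 that goods
  cannot have run out, and for the others a pair worth more than 1 is made up for by the bundles
  of their partition. Otherwise pair \<open>k\<close> with \<open>n+k\<close> and prefer the agents that are not tight;
  since these are few, nearly all bags are worth less than \<open>3/4 + d\<close> to them. For the tight agents
  this pairing has the advantage that the values of the pairs are monotone, hence pairs just below
  \<open>3/4 + d\<close>, the only ones that can be filled to more than 1, look nearly alike. A weighting of
  the goods then gives every bundle of her partition weight at least 4, but every bag at most 4 on
  average.
\<close>

section \<open>Bundles and allocations\<close>

lemma card_mult_le_sum_fibres: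
  fixes f :: "'a \<Rightarrow> real" and t :: real
  assumes "finite A" "finite J" "\<pi> ` A \<subseteq> J" and "\<And>j. j \<in> J \<Longrightarrow> t \<le> sum f {x \<in> A. \<pi> x = j}"
  shows "card J * t \<le> sum f A"
proof -
  have "(\<Sum>j\<in>J. t) \<le> (\<Sum>j\<in>J. sum f {x \<in> A. \<pi> x = j})" using assms(4) by (rule sum_mono)
  then show ?thesis by (simp add: sum.group[OF assms(1-3)])
qed

lemma pigeonhole_sum_fibres:
  fixes f :: "'a \<Rightarrow> real" and t :: real
  assumes "finite A" "finite J" "\<pi> ` A \<subseteq> J" "card J * t < sum f A"
  obtains j where "j \<in> J" "t < sum f {x \<in> A. \<pi> x = j}"
proof (rule ccontr)
  assume "\<not> thesis"
  then have "\<forall>j\<in>J. sum f {x \<in> A. \<pi> x = j} \<le> t" using that not_less by blast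
  then have "(\<Sum>j\<in>J. sum f {x \<in> A. \<pi> x = j}) \<le> (\<Sum>j\<in>J. t)" by (intro sum_mono) auto
  then show False using assms(4) by (simp add: sum.group[OF assms(1-3)])
qed

definition satisfiable :: "real \<Rightarrow> 'i set \<Rightarrow> ('i \<Rightarrow> 'g \<Rightarrow> real) \<Rightarrow> 'g set \<Rightarrow> bool" where
  "satisfiable t N v G \<longleftrightarrow>
     (\<exists>A. disjoint_family_on A N \<and> (\<forall>i\<in>N. A i \<subseteq> G \<and> t \<le> sum (v i) (A i)))"

lemma satisfiableI:
  assumes "disjoint_family_on A N" "\<And>i. i \<in> N \<Longrightarrow> A i \<subseteq> G" "\<And>i. i \<in> N \<Longrightarrow> t \<le> sum (v i) (A i)"
  shows "satisfiable t N v G"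
  using assms unfolding satisfiable_def by blast

lemma satisfiableE:
  assumes "satisfiable t N v G"
  obtains A where "disjoint_family_on A N" "\<And>i. i \<in> N \<Longrightarrow> A i \<subseteq> G"
    "\<And>i. i \<in> N \<Longrightarrow> t \<le> sum (v i) (A i)"
  using assms unfolding satisfiable_def by blast

lemma satisfiable_antimono: "satisfiable t N v G \<Longrightarrow> t' \<le> t \<Longrightarrow> satisfiable t' N v G"
  unfolding satisfiable_def by (meson order_trans)

lemma satisfiable_insert:
  assumes "satisfiable t N v (G - S)" "S \<subseteq> G" "t \<le> sum (v i) S" "i \<notin> N"
  shows "satisfiable t (insert i N) v G"
proof -
  obtain A where alloc: "disjoint_family_on A N" "\<And>k. k \<in> N \<Longrightarrow> A k \<subseteq> G - S"
    "\<And>k. k \<in> N \<Longrightarrow> t \<le> sum (v k) (A k)"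
    using assms(1) by (rule satisfiableE) blast
  show ?thesis
  proof (rule satisfiableI)
    show "disjoint_family_on (A(i := S)) (insert i N)"
      using alloc(1,2) assms(4) by (fastforce simp: disjoint_family_on_def)
    show "(A(i := S)) k \<subseteq> G" if "k \<in> insert i N" for k using that alloc(2)[of k] assms(2) by auto
    show "t \<le> sum (v k) ((A(i := S)) k)" if "k \<in> insert i N" for k
      using that alloc(3)[of k] assms(3) by auto
  qed
qed

lemma satisfiable_image:
  assumes "satisfiable t N (\<lambda>i g. v i (e g)) G" "inj_on e G" "e ` G \<subseteq> H"
  shows "satisfiable t N v H"
proof -
  obtain A where alloc: "disjoint_family_on A N" "\<And>i. i \<in> N \<Longrightarrow> A i \<subseteq> G"
    "\<And>i. i \<in> N \<Longrightarrow> t \<le> (\<Sum>g\<in>A i. v i (e g))"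
    using assms(1) by (rule satisfiableE) blast
  show ?thesis
  proof (rule satisfiableI)
    show "disjoint_family_on (\<lambda>i. e ` A i) N" unfolding disjoint_family_on_def
    proof (intro ballI impI)
      fix i k assume "i \<in> N" "k \<in> N" "i \<noteq> k"
      then show "e ` A i \<inter> e ` A k = {}"
        using disjoint_family_onD[OF alloc(1)]
        by (simp flip: inj_on_image_Int[OF assms(2) alloc(2) alloc(2)])
    qed
    show "e ` A i \<subseteq> H" if "i \<in> N" for i using alloc(2)[OF that] assms(3) by blast
    show "t \<le> sum (v i) (e ` A i)" if "i \<in> N" for i
      using alloc(3)[OF that] inj_on_subset[OF assms(2) alloc(2)[OF that]]
      by (simp add: sum.reindex)
  qed
qed

lemma satisfiable_scale:
  assumes "satisfiable (a * t) N w G" "0 < a" "\<And>i g. i \<in> N \<Longrightarrow> g \<in> G \<Longrightarrow> w i g \<le> a * v i g"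
  shows "satisfiable t N v G"
proof -
  obtain A where alloc: "disjoint_family_on A N" "\<And>i. i \<in> N \<Longrightarrow> A i \<subseteq> G"
    "\<And>i. i \<in> N \<Longrightarrow> a * t \<le> sum (w i) (A i)"
    using assms(1) by (rule satisfiableE) blast
  show ?thesis
  proof (rule satisfiableI[OF alloc(1,2)])
    fix i assume "i \<in> N"
    then have "sum (w i) (A i) \<le> a * sum (v i) (A i)"
      unfolding sum_distrib_left using alloc(2) assms(3) by (intro sum_mono) auto
    with alloc(3)[OF \<open>i \<in> N\<close>] have "a * t \<le> a * sum (v i) (A i)" by simp
    then show "t \<le> sum (v i) (A i)" using assms(2) by simp
  qed
qed

lemma satisfiable_drop_worthless:
  assumes "satisfiable t N v G" "finite G" "\<And>i g. i \<in> N \<Longrightarrow> g \<in> G - H \<Longrightarrow> v i g = 0"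
  shows "satisfiable t N v (G \<inter> H)"
proof -
  obtain A where alloc: "disjoint_family_on A N" "\<And>i. i \<in> N \<Longrightarrow> A i \<subseteq> G"
    "\<And>i. i \<in> N \<Longrightarrow> t \<le> sum (v i) (A i)"
    using assms(1) by (rule satisfiableE) blast
  show ?thesis
  proof (rule satisfiableI)
    show "disjoint_family_on (\<lambda>i. A i \<inter> H) N" using alloc(1) by (auto simp: disjoint_family_on_def)
    show "A i \<inter> H \<subseteq> G \<inter> H" if "i \<in> N" for i using alloc(2)[OF that] by blast
    fix i assume agent: "i \<in> N"
    have "sum (v i) (A i) = sum (v i) (A i \<inter> H)"
      by (rule sum.mono_neutral_right)
        (use alloc(2)[OF agent] assms(2,3) agent in \<open>auto intro: finite_subset\<close>)
    then show "t \<le> sum (v i) (A i \<inter> H)" using alloc(3)[OF agent] by simp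
  qed
qed

section \<open>Sorting the goods\<close>

lemma ex_decreasing_enumeration:
  fixes f :: "'a \<Rightarrow> real"
  assumes "finite M"
  obtains e where "bij_betw e {..<card M} M" "antimono_on {..<card M} (f \<circ> e)"
proof -
  obtain xs where set_xs: "set xs = M" "distinct xs" using finite_distinct_list[OF assms] by blast
  define ys where "ys = sort_key (\<lambda>x. - f x) xs"
  have sorted_ys: "set ys = M" "distinct ys" "sorted (map (\<lambda>x. - f x) ys)" using set_xs
    by (auto simp: ys_def)
  then have length_ys: "length ys = card M" using distinct_card by force
  show ?thesis
  proof
    show "bij_betw ((!) ys) {..<card M} M" using sorted_ys length_ys by (intro bij_betw_nth) auto
    show "antimono_on {..<card M} (f \<circ> (!) ys)"
      using sorted_nth_mono[OF sorted_ys(3)] length_ys by (auto intro!: monotone_onI)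
  qed
qed

lemma inj_on_atMost_escapes:
  assumes "inj_on f {..k :: nat}" "finite B" "card B \<le> k"
  shows "\<exists>i\<le>k. f i \<notin> B"
proof -
  have "\<not> f ` {..k} \<subseteq> B"
    using card_mono[OF assms(2), of "f ` {..k}"] card_image[OF assms(1)] assms(3) by auto
  then show ?thesis by blast
qed

lemma decreasing_rearrangement_le:
  fixes f U :: "nat \<Rightarrow> real"
  assumes sorting: "bij_betw e {..<m} {..<m}" "antimono_on {..<m} (f \<circ> e)"
    and "antimono U" "\<And>g. g < m \<Longrightarrow> f g \<le> U g" "k < m"
  shows "f (e k) \<le> U k"
proof -
  have "inj_on e {..k}"
    using bij_betw_imp_inj_on[OF sorting(1)] by (rule inj_on_subset) (use assms(5) in auto)
  then obtain i where late: "i \<le> k" "k \<le> e i"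
    using inj_on_atMost_escapes[of e k "{..<k}"] by auto
  have "f (e k) \<le> f (e i)" using monotone_onD[OF sorting(2), of i k] late assms(5) by simp
  also have "\<dots> \<le> U (e i)" using bij_betwE[OF sorting(1)] late assms(4,5) by simp
  also have "\<dots> \<le> U k" using antimonoD[OF assms(3) late(2)] .
  finally show ?thesis .
qed

lemma picking_sequence:
  fixes v :: "'i \<Rightarrow> 'g \<Rightarrow> real" and e :: "'i \<Rightarrow> nat \<Rightarrow> 'g"
  assumes enumeration: "\<And>k. k < m \<Longrightarrow> bij_betw (e (p k)) {..<m} M"
    and decreasing: "\<And>k. k < m \<Longrightarrow> antimono_on {..<m} (v (p k) \<circ> e (p k))"
    and "t \<le> m"
  shows "\<exists>f. inj_on f {..<t} \<and> f ` {..<t} \<subseteq> M \<and> (\<forall>k<t. v (p k) (e (p k) k) \<le> v (p k) (f k))"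
  using assms(3)
proof (induction t)
  case 0
  then show ?case by auto
next
  case (Suc t)
  then obtain f where picks: "inj_on f {..<t}" "f ` {..<t} \<subseteq> M"
    "\<forall>k<t. v (p k) (e (p k) k) \<le> v (p k) (f k)"
    by auto
  have t_less: "t < m" using Suc.prems by simp
  have "inj_on (e (p t)) {..t}"
    using bij_betw_imp_inj_on[OF enumeration[OF t_less]]
    by (rule inj_on_subset) (use t_less in auto)
  then obtain i where free: "i \<le> t" "e (p t) i \<notin> f ` {..<t}"
    using inj_on_atMost_escapes[of "e (p t)" t "f ` {..<t}"] card_image[OF picks(1)] by auto
  let ?f = "f(t := e (p t) i)"
  have "inj_on ?f {..<Suc t}"
    using picks(1) free(2) by (force simp: lessThan_Suc inj_on_def)
  moreover have "e (p t) i \<in> M" using enumeration[OF t_less] free(1) t_less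
    by (auto simp: bij_betw_def)
  then have "?f ` {..<Suc t} \<subseteq> M" using picks(2) by (auto simp: lessThan_Suc)
  moreover have "v (p t) (e (p t) t) \<le> v (p t) (e (p t) i)"
    using monotone_onD[OF decreasing[OF t_less], of i t] free(1) t_less by simp
  then have "\<forall>k<Suc t. v (p k) (e (p k) k) \<le> v (p k) (?f k)" using picks(3)
    by (simp add: less_Suc_eq)
  ultimately show ?case by blast
qed

lemma satisfiable_unsort:
  fixes v :: "'i \<Rightarrow> 'g \<Rightarrow> real" and e :: "'i \<Rightarrow> nat \<Rightarrow> 'g"
  assumes sorted: "satisfiable t N (\<lambda>i. v i \<circ> e i) {..<m}"
    and enumeration: "\<And>i. i \<in> N \<Longrightarrow> bij_betw (e i) {..<m} M"
    and decreasing: "\<And>i. i \<in> N \<Longrightarrow> antimono_on {..<m} (v i \<circ> e i)"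
  shows "satisfiable t N v M"
proof (cases "N = {}")
  case True
  then show ?thesis by (simp add: satisfiable_def disjoint_family_on_def)
next
  case False
  obtain A where alloc: "disjoint_family_on A N" "\<And>i. i \<in> N \<Longrightarrow> A i \<subseteq> {..<m}"
    "\<And>i. i \<in> N \<Longrightarrow> t \<le> (\<Sum>k\<in>A i. v i (e i k))"
    using sorted by (rule satisfiableE) (simp add: o_def)
  have "\<exists>i\<in>N. \<forall>j\<in>N. k \<in> A j \<longrightarrow> i = j" for k
    using disjoint_family_onD[OF alloc(1)] False by (cases "\<exists>i\<in>N. k \<in> A i") blast+
  then obtain p where owner: "\<And>k. p k \<in> N" "\<And>k i. i \<in> N \<Longrightarrow> k \<in> A i \<Longrightarrow> p k = i" by metis
  obtain f where picks: "inj_on f {..<m}" "f ` {..<m} \<subseteq> M"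
    "\<And>k. k < m \<Longrightarrow> v (p k) (e (p k) k) \<le> v (p k) (f k)"
    using picking_sequence[of m e p M v m] enumeration decreasing owner(1) by blast
  have "satisfiable t N (\<lambda>i k. v i (f k)) {..<m}"
  proof (rule satisfiableI[OF alloc(1,2)])
    fix i assume agent: "i \<in> N"
    have "(\<Sum>k\<in>A i. v i (e i k)) \<le> (\<Sum>k\<in>A i. v i (f k))"
      by (rule sum_mono) (use alloc(2)[OF agent] owner(2)[OF agent] picks(3) in force)
    with alloc(3)[OF agent] show "t \<le> (\<Sum>k\<in>A i. v i (f k))" by simp
  qed
  from satisfiable_image[OF this picks(1,2)] show ?thesis .
qed

section \<open>Bag filling\<close>

lemma mono_const_after:
  fixes c :: "nat \<Rightarrow> nat"
  assumes "mono c" "c s \<le> e"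
  shows "mono (\<lambda>k. if k \<le> s then c k else e)"
proof (rule monoI)
  fix j k :: nat assume "j \<le> k"
  then show "(if j \<le> s then c j else e) \<le> (if k \<le> s then c k else e)"
    using monoD[OF assms(1), of j s] monoD[OF assms(1), of j k] assms(2) by auto
qed

definition bag :: "(nat \<Rightarrow> nat set) \<Rightarrow> (nat \<Rightarrow> nat) \<Rightarrow> nat \<Rightarrow> nat set" where
  "bag B c k = B k \<union> {c k..<c (Suc k)}"

locale initial_bags =
  fixes n l :: nat and B :: "nat \<Rightarrow> nat set"
  assumes disjoint_initial: "disjoint_family_on B {..<n}" and UN_initial: "(\<Union>k<n. B k) = {..<l}"
begin

lemma initial_subset: "k < n \<Longrightarrow> B k \<subseteq> {..<l}"
  using UN_initial by blast

lemma finite_initial: "k < n \<Longrightarrow> finite (B k)"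
  using initial_subset by (rule finite_subset) auto

lemma cutoff_ge:
  fixes c :: "nat \<Rightarrow> nat"
  assumes "mono c" "c 0 = l"
  shows "l \<le> c k"
  using monoD[OF assms(1), of 0 k] assms(2) by simp

lemma sum_bag:
  fixes f :: "nat \<Rightarrow> real"
  assumes "mono c" "c 0 = l" "k < n"
  shows "sum f (B k \<union> {c k..<e}) = sum f (B k) + sum f {c k..<e}"
  using cutoff_ge[OF assms(1,2), of k] initial_subset[OF assms(3)] finite_initial[OF assms(3)]
  by (intro sum.union_disjoint) auto

lemma disjoint_bags:
  assumes "mono c" "c 0 = l"
  shows "disjoint_family_on (bag B c) {..<n}"
proof -
  have "bag B c j \<inter> bag B c k = {}" if "j < k" "k < n" for j k
  proof -
    have "B j \<inter> B k = {}" using disjoint_family_onD[OF disjoint_initial, of j k] that by auto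
    moreover have "c (Suc j) \<le> c k" using that by (intro monoD[OF assms(1)]) simp
    ultimately show ?thesis
      using initial_subset[of j] initial_subset[of k] cutoff_ge[OF assms, of j]
        cutoff_ge[OF assms, of k] that
      by (fastforce simp: bag_def)
  qed
  then show ?thesis unfolding disjoint_family_on_def
    by (metis Int_commute lessThan_iff linorder_neqE_nat)
qed

lemma UN_bags:
  assumes "mono c" "c 0 = l"
  shows "(\<Union>k<n. bag B c k) = {..<c n}"
proof -
  have "(\<Union>k<j. {c k..<c (Suc k)}) = {l..<c j}" for j
  proof (induction j)
    case (Suc j)
    then show ?case using cutoff_ge[OF assms, of j] incseq_SucD[OF assms(1), of j]
      by (simp add: lessThan_Suc ivl_disj_un_two(3) Un_commute)
  qed (simp add: assms(2))
  then have "(\<Union>k<n. bag B c k) = {..<l} \<union> {l..<c n}"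
    unfolding bag_def UN_Un_distrib UN_initial by simp
  then show ?thesis using cutoff_ge[OF assms, of n] by auto
qed

lemma sum_bags:
  fixes f :: "nat \<Rightarrow> real"
  assumes "mono c" "c 0 = l"
  shows "sum f {..<c n} = (\<Sum>k<n. sum f (bag B c k))"
  unfolding UN_bags[OF assms, symmetric]
  using disjoint_bags[OF assms] finite_initial
  by (intro sum.UNION_disjoint) (auto simp: disjoint_family_on_def bag_def)

end

text \<open>What an agent with valuation \<open>w\<close> who received nothing has seen when the goods ran out while
  bag \<open>s\<close> was being filled.\<close>

locale stuck_bags = initial_bags n l B for n l B +
  fixes m :: nat and t :: real and w :: "nat \<Rightarrow> real" and c :: "nat \<Rightarrow> nat" and s :: nat
  assumes stuck_less: "s < n" and cutoff_mono: "mono c" and cutoff_0: "c 0 = l"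
    and cutoff_after: "s < k \<Longrightarrow> c k = m"
    and before_last: "k < s \<Longrightarrow> c k < c (Suc k) \<Longrightarrow> sum w (B k \<union> {c k..<c (Suc k) - 1}) < t"
    and stuck_value: "sum w (bag B c s) < t"
begin

lemmas cutoff_ge_l = cutoff_ge[OF cutoff_mono cutoff_0]

lemma sum_bag_eq:
  fixes f :: "nat \<Rightarrow> real"
  assumes "k < n"
  shows "sum f (bag B c k) = sum f (B k) + sum f {c k..<c (Suc k)}"
  unfolding bag_def using assms by (rule sum_bag[OF cutoff_mono cutoff_0])

lemma sum_goods_eq:
  fixes f :: "nat \<Rightarrow> real"
  shows "sum f {..<m} = (\<Sum>k<n. sum f (bag B c k))"
  using sum_bags[OF cutoff_mono cutoff_0, of f] cutoff_after[OF stuck_less] by simp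

lemma sum_goods_less:
  fixes f :: "nat \<Rightarrow> real" and x :: real
  assumes "\<And>k. k < n \<Longrightarrow> sum f (bag B c k) \<le> x" "sum f (bag B c s) < x"
  shows "sum f {..<m} < n * x"
proof -
  have "(\<Sum>k<n. sum f (bag B c k)) < (\<Sum>k<n. x)"
    by (rule sum_strict_mono_ex1) (use assms stuck_less in auto)
  then show ?thesis by (simp add: sum_goods_eq)
qed

lemma before_last_less:
  assumes "c k < c (Suc k)" "\<And>g. 0 \<le> w g"
  shows "sum w (B k \<union> {c k..<c (Suc k) - 1}) < t"
proof -
  have "\<not> s < k" using assms(1) cutoff_after[of k] cutoff_after[of "Suc k"] by auto
  then consider (filled) "k < s" | (stuck) "k = s" by linarith
  then show ?thesis
  proof cases
    case stuck
    have "sum w (B s \<union> {c s..<c (Suc s) - 1}) \<le> sum w (bag B c s)"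
      unfolding bag_def using finite_initial[OF stuck_less] assms(2) by (intro sum_mono2) auto
    then show ?thesis using stuck_value stuck by simp
  qed (use before_last assms(1) in auto)
qed

end

locale bag_filling = initial_bags n l B for n l B +
  fixes m :: nat and t :: real and N :: "'i set" and w :: "'i \<Rightarrow> nat \<Rightarrow> real" and Q :: "'i set"
  assumes finite_agents: "finite N" and card_agents: "card N = n" and enough_goods: "l \<le> m"
begin

text \<open>Agent \<open>\<sigma> k\<close> has received bag \<open>k\<close>; those in \<open>Q\<close> take precedence.\<close>

definition partial_filling :: "nat \<Rightarrow> (nat \<Rightarrow> 'i) \<Rightarrow> (nat \<Rightarrow> nat) \<Rightarrow> bool" where
  "partial_filling s \<sigma> c \<longleftrightarrow> inj_on \<sigma> {..<s} \<and> \<sigma> ` {..<s} \<subseteq> N \<and> mono c \<and> c 0 = l \<and> c s \<le> m \<and>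
     (\<forall>k<s. t \<le> sum (w (\<sigma> k)) (bag B c k)) \<and>
     (\<forall>i\<in>N - \<sigma> ` {..<s}. \<forall>k<s.
        (c k < c (Suc k) \<longrightarrow> sum (w i) (B k \<union> {c k..<c (Suc k) - 1}) < t) \<and>
        (i \<in> Q \<longrightarrow> \<sigma> k \<notin> Q \<longrightarrow> sum (w i) (bag B c k) < t))"

lemma partial_filling_fill:
  assumes filling: "partial_filling s \<sigma> c" and stop: "c s \<le> e" "e \<le> m"
    and receiver: "j \<in> N - \<sigma> ` {..<s}" "t \<le> sum (w j) (B s \<union> {c s..<e})"
    and before: "\<And>i. c s < e \<Longrightarrow> i \<in> N - \<sigma> ` {..<s} \<Longrightarrow> sum (w i) (B s \<union> {c s..<e - 1}) < t"
    and precedence: "\<And>i. i \<in> N - \<sigma> ` {..<s} \<Longrightarrow> i \<in> Q \<Longrightarrow> j \<notin> Q \<Longrightarrow> sum (w i) (B s \<union> {c s..<e}) < t"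
  shows "partial_filling (Suc s) (\<sigma>(s := j)) (\<lambda>k. if k \<le> s then c k else e)"
    (is "partial_filling _ ?\<sigma> ?c")
proof -
  have image: "?\<sigma> ` {..<Suc s} = insert j (\<sigma> ` {..<s})" by (auto simp: lessThan_Suc)
  have bag_before: "bag B ?c k = bag B c k" if "k < s" for k using that by (simp add: bag_def)
  have bag_s: "bag B ?c s = B s \<union> {c s..<e}" by (simp add: bag_def)
  show ?thesis unfolding partial_filling_def
  proof (intro conjI allI ballI impI)
    show "inj_on ?\<sigma> {..<Suc s}"
      using filling receiver(1) by (auto simp: partial_filling_def lessThan_Suc inj_on_def)
    show "?\<sigma> ` {..<Suc s} \<subseteq> N" unfolding image using filling receiver(1)
      by (auto simp: partial_filling_def)
    show "mono ?c" using filling stop(1)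
      by (intro mono_const_after) (auto simp: partial_filling_def)
    show "?c 0 = l" "?c (Suc s) \<le> m" using filling stop(2) by (auto simp: partial_filling_def)
    show "t \<le> sum (w (?\<sigma> k)) (bag B ?c k)" if "k < Suc s" for k
      using that filling receiver(2) bag_before bag_s
      by (cases "k = s") (auto simp: partial_filling_def)
    fix i k assume unserved_after: "i \<in> N - ?\<sigma> ` {..<Suc s}" and bag_number: "k < Suc s"
    then have unserved: "i \<in> N - \<sigma> ` {..<s}" using image by blast
    show "sum (w i) (B k \<union> {?c k..<?c (Suc k) - 1}) < t" if "?c k < ?c (Suc k)"
      using that filling unserved bag_number before
      by (cases "k = s") (auto simp: partial_filling_def)
    show "sum (w i) (bag B ?c k) < t" if "i \<in> Q" "?\<sigma> k \<notin> Q"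
      using that filling unserved bag_number precedence bag_before bag_s
      by (cases "k = s") (auto simp: partial_filling_def)
  qed
qed

lemma partial_filling_extend:
  assumes filling: "partial_filling s \<sigma> c"
    and unserved: "i \<in> N - \<sigma> ` {..<s}" "t \<le> sum (w i) (B s \<union> {c s..<m})"
  shows "\<exists>\<sigma>' c'. partial_filling (Suc s) \<sigma>' c'"
proof -
  define fills where "fills e \<longleftrightarrow> c s \<le> e \<and> (\<exists>j\<in>N - \<sigma> ` {..<s}. t \<le> sum (w j) (B s \<union> {c s..<e}))"
    for e
  define e where "e = (LEAST e. fills e)"
  have "c s \<le> m" using filling by (simp add: partial_filling_def)
  then have "fills m" using unserved by (auto simp: fills_def)
  then have stop: "fills e" "e \<le> m" unfolding e_def by (rule LeastI, rule Least_le)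
  then obtain j where receiver: "j \<in> N - \<sigma> ` {..<s}" "t \<le> sum (w j) (B s \<union> {c s..<e})"
    and precedence: "\<And>i. i \<in> N - \<sigma> ` {..<s} \<Longrightarrow> i \<in> Q \<Longrightarrow> j \<notin> Q \<Longrightarrow> sum (w i) (B s \<union> {c s..<e}) < t"
    unfolding fills_def by (meson not_le)
  have "sum (w i) (B s \<union> {c s..<e - 1}) < t" if "c s < e" "i \<in> N - \<sigma> ` {..<s}" for i
  proof -
    have "\<not> fills (e - 1)" using not_less_Least[of "e - 1" fills] that(1) by (simp add: e_def)
    then show ?thesis using that by (auto simp: fills_def not_le)
  qed
  then show ?thesis using partial_filling_fill[OF filling _ stop(2) receiver] precedence stop(1)
    by (auto simp: fills_def)
qed

lemma ex_maximal_filling: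
  obtains s \<sigma> c where "s \<le> n" "partial_filling s \<sigma> c"
    "\<And>i. i \<in> N - \<sigma> ` {..<s} \<Longrightarrow> sum (w i) (B s \<union> {c s..<m}) < t"
proof -
  define reachable where "reachable s \<longleftrightarrow> (\<exists>\<sigma> c. partial_filling s \<sigma> c)" for s
  have "partial_filling 0 \<sigma> (\<lambda>_. l)" for \<sigma>
    using enough_goods by (simp add: partial_filling_def mono_def)
  then have "reachable 0" by (auto simp: reachable_def)
  moreover have reachable_le: "s \<le> n" if "reachable s" for s
  proof -
    from that obtain \<sigma> where "inj_on \<sigma> {..<s}" "\<sigma> ` {..<s} \<subseteq> N"
      by (auto simp: reachable_def partial_filling_def)
    then show "s \<le> n" using card_inj_on_le[of \<sigma> "{..<s}" N] finite_agents card_agents by simp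
  qed
  ultimately have reachable_Greatest: "reachable (Greatest reachable)" by (rule GreatestI_nat)
  then obtain \<sigma> c where filling: "partial_filling (Greatest reachable) \<sigma> c"
    by (auto simp: reachable_def)
  have maximal: "\<not> reachable (Suc (Greatest reachable))"
    using Greatest_le_nat[of reachable "Suc (Greatest reachable)" n] reachable_le by fastforce
  show ?thesis
  proof (rule that[OF reachable_le[OF reachable_Greatest] filling])
    fix i assume "i \<in> N - \<sigma> ` {..<Greatest reachable}"
    then show "sum (w i) (B (Greatest reachable) \<union> {c (Greatest reachable)..<m}) < t"
      using partial_filling_extend[OF filling] maximal unfolding reachable_def by (meson not_le)
  qed
qed

lemma satisfiable_if_filled:
  assumes "partial_filling n \<sigma> c"
  shows "satisfiable t N w {..<m}"
proof -
  have receivers: "inj_on \<sigma> {..<n}" "\<sigma> ` {..<n} \<subseteq> N" and cutoffs: "mono c" "c 0 = l" "c n \<le> m"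
    and worth: "\<And>k. k < n \<Longrightarrow> t \<le> sum (w (\<sigma> k)) (bag B c k)"
    using assms by (auto simp: partial_filling_def)
  have "\<sigma> ` {..<n} = N"
    using receivers finite_agents card_agents by (intro card_subset_eq) (auto simp: card_image)
  then have bij: "bij_betw \<sigma> {..<n} N" using receivers(1) by (simp add: bij_betw_def)
  define \<tau> where "\<tau> = inv_into {..<n} \<sigma>"
  have bag_of: "bij_betw \<tau> N {..<n}" "\<And>i. i \<in> N \<Longrightarrow> \<sigma> (\<tau> i) = i"
    unfolding \<tau>_def using bij by (auto simp: bij_betw_inv_into bij_betw_inv_into_right)
  have bag_of_less: "\<tau> i < n" if "i \<in> N" for i using bij_betwE[OF bag_of(1)] that by auto
  show ?thesis
  proof (rule satisfiableI)
    show "disjoint_family_on (\<lambda>i. bag B c (\<tau> i)) N" unfolding disjoint_family_on_def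
    proof (intro ballI impI)
      fix i j assume agents: "i \<in> N" "j \<in> N" "i \<noteq> j"
      then have "\<tau> i \<noteq> \<tau> j" using bag_of(2) by metis
      then show "bag B c (\<tau> i) \<inter> bag B c (\<tau> j) = {}"
        using bag_of_less agents
        by (intro disjoint_family_onD[OF disjoint_bags[OF cutoffs(1,2)]]) auto
    qed
    show "bag B c (\<tau> i) \<subseteq> {..<m}" if "i \<in> N" for i
    proof -
      have "bag B c (\<tau> i) \<subseteq> (\<Union>k<n. bag B c k)" using bag_of_less[OF that] by blast
      then show ?thesis using UN_bags[OF cutoffs(1,2)] cutoffs(3) by auto
    qed
    show "t \<le> sum (w i) (bag B c (\<tau> i))" if "i \<in> N" for i
      using worth[OF bag_of_less[OF that]] bag_of(2)[OF that] by simp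
  qed
qed

lemma stuck_bags_if_unserved:
  assumes filling: "partial_filling s \<sigma> c" and bag_left: "s < n" and unserved: "i \<in> N - \<sigma> ` {..<s}"
    and unfillable: "sum (w i) (B s \<union> {c s..<m}) < t"
  shows "stuck_bags n l B m t (w i) (\<lambda>k. if k \<le> s then c k else m) s"
    (is "stuck_bags n l B m t (w i) ?c s")
proof
  show "s < n" by (rule bag_left)
  show "mono ?c" using filling by (intro mono_const_after) (auto simp: partial_filling_def)
  show "?c 0 = l" "\<And>k. s < k \<Longrightarrow> ?c k = m" using filling by (auto simp: partial_filling_def)
  show "sum (w i) (B k \<union> {?c k..<?c (Suc k) - 1}) < t" if "k < s" "?c k < ?c (Suc k)" for k
    using filling unserved that by (auto simp: partial_filling_def)
  show "sum (w i) (bag B ?c s) < t" using unfillable by (simp add: bag_def)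
qed

text \<open>\<open>S\<close> consists of the bags that went to agents with precedence.\<close>

lemma satisfiable_or_stuck:
  obtains (satisfied) "satisfiable t N w {..<m}"
  | (stuck) i c s S where "i \<in> N" "stuck_bags n l B m t (w i) c s" "S \<subseteq> {..<s}"
      "card S \<le> card (Q \<inter> N)"
      "\<And>k. i \<in> Q \<Longrightarrow> k < s \<Longrightarrow> k \<notin> S \<Longrightarrow> sum (w i) (bag B c k) < t"
proof -
  obtain s \<sigma> c where filling: "s \<le> n" "partial_filling s \<sigma> c"
    and unfillable: "\<And>i. i \<in> N - \<sigma> ` {..<s} \<Longrightarrow> sum (w i) (B s \<union> {c s..<m}) < t"
    by (rule ex_maximal_filling) blast
  show ?thesis
  proof (cases "s = n")
    case True
    then show ?thesis using satisfiable_if_filled filling(2) that(1) by blast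
  next
    case False
    then have "s < n" using filling(1) by simp
    have receivers: "inj_on \<sigma> {..<s}" "\<sigma> ` {..<s} \<subseteq> N" using filling(2)
      by (auto simp: partial_filling_def)
    have "card (\<sigma> ` {..<s}) < card N" using card_image[OF receivers(1)] \<open>s < n\<close> card_agents by simp
    then have "\<sigma> ` {..<s} \<noteq> N" by auto
    then obtain i where unserved: "i \<in> N - \<sigma> ` {..<s}" using receivers(2) by blast
    let ?c = "\<lambda>k. if k \<le> s then c k else m" and ?S = "{k. k < s \<and> \<sigma> k \<in> Q}"
    show ?thesis
    proof (rule that(2))
      show "stuck_bags n l B m t (w i) ?c s"
        using filling(2) \<open>s < n\<close> unserved unfillable[OF unserved] by (rule stuck_bags_if_unserved)
      show "card ?S \<le> card (Q \<inter> N)"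
      proof (rule card_inj_on_le)
        show "inj_on \<sigma> ?S" using receivers(1) by (rule inj_on_subset) auto
      qed (use receivers(2) finite_agents in auto)
      show "sum (w i) (bag B ?c k) < t" if "i \<in> Q" "k < s" "k \<notin> ?S" for k
        using filling(2) unserved that by (auto simp: partial_filling_def bag_def)
    qed (use unserved in auto)
  qed
qed

end

section \<open>Slot weights\<close>

text \<open>A bundle of value 1 is described by the numbers \<open>a\<close>, \<open>b\<close>, \<open>r\<close> of its goods of three
  kinds. Its weight is bounded from below in two ways: by counting, or by its value minus a loss
  per good; for all \<open>a\<close>, \<open>b\<close>, \<open>r\<close> one of the two bounds suffices.\<close>

lemma slot_weight_ge:
  fixes \<alpha> \<beta> \<gamma> :: real and a b r :: nat
  assumes weights: "1 \<le> \<gamma>" "\<gamma> \<le> \<beta>" "\<beta> \<le> \<alpha>" "\<alpha> + \<beta> + \<gamma> = 4"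
    and many: "4 \<le> a + b + r \<or> 1 \<le> a \<and> 2 \<le> a + b \<and> 3 \<le> a + b + r"
  shows "4 \<le> a * \<alpha> + b * \<beta> + r * \<gamma>"
  using many
proof
  assume "4 \<le> a + b + r"
  then have "4 * \<gamma> \<le> real (a + b + r) * \<gamma>" using weights by (intro mult_right_mono) auto
  also have "\<dots> = a * \<gamma> + b * \<gamma> + r * \<gamma>" by (simp add: algebra_simps)
  also have "\<dots> \<le> a * \<alpha> + b * \<beta> + r * \<gamma>" using weights by (intro add_mono mult_left_mono) auto
  finally show ?thesis using weights(1) by linarith
next
  assume with_a: "1 \<le> a \<and> 2 \<le> a + b \<and> 3 \<le> a + b + r"
  have "4 = \<alpha> + (\<beta> + \<gamma>)" using weights(4) by simp
  also have "\<gamma> \<le> (real (a + b + r) - 3) * \<gamma> + \<gamma>" using with_a weights(1) by simp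
  also have "\<dots> \<le> (real (a + b) - 2) * \<beta> + r * \<gamma>"
    using mult_left_mono[OF weights(2), of "real (a + b) - 2"] with_a by (simp add: algebra_simps)
  also have "\<alpha> + (\<beta> + \<dots>) \<le> a * \<alpha> + b * \<beta> + r * \<gamma>"
    using mult_left_mono[OF weights(3), of "real a - 1"] with_a by (simp add: algebra_simps)
  finally show ?thesis by simp
qed

lemma slot_weight_ge_or_loss_le:
  fixes \<alpha> \<beta> \<gamma> la lb lr e :: real and a b r :: nat
  assumes weights: "1 \<le> \<gamma>" "\<gamma> \<le> \<beta>" "\<beta> \<le> \<alpha>" "\<alpha> + \<beta> + \<gamma> = 4"
    and lr_nonneg: "0 \<le> lr"
    and loss_arr: "4 \<le> \<alpha> + \<gamma> + \<gamma> \<or> la + lr + lr \<le> e" and loss_ar: "la + lr \<le> e"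
    and loss_aa: "4 \<le> \<alpha> + \<alpha> \<or> la + la \<le> e" and loss_ab: "la + lb \<le> e"
    and loss_bbb: "4 \<le> \<beta> + \<beta> + \<beta> \<or> lb + lb + lb \<le> e"
    and loss_bbr: "4 \<le> \<beta> + \<beta> + \<gamma> \<or> lb + lb + lr \<le> e"
    and loss_bb: "lb + lb \<le> e" and loss_brr: "lb + lr + lr \<le> e" and loss_rrr: "lr + lr + lr \<le> e"
  shows "4 \<le> a * \<alpha> + b * \<beta> + r * \<gamma> \<or> a * la + b * lb + r * lr \<le> e"
proof (cases "4 \<le> a + b + r \<or> 1 \<le> a \<and> 2 \<le> a + b \<and> 3 \<le> a + b + r")
  case True
  then show ?thesis using slot_weight_ge[OF weights] by blast
next
  case False
  have few: "r * lr \<le> real k * lr" if "r \<le> k" for k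
    using that lr_nonneg by (intro mult_right_mono) auto
  consider (no_a) "a = 0" "b + r \<le> 3" | (only_a) "a = 1" "b = 0" "r \<le> 2"
    | (ab) "a = 1" "b = 1" "r = 0" | (aa) "a = 2" "b = 0" "r = 0"
    using False by linarith
  then show ?thesis
  proof cases
    case no_a
    then consider (only_r) "b = 0" "r \<le> 3" | (one_b) "b = 1" "r \<le> 2" | (bb) "b = 2" "r = 0"
      | (bbr) "b = 2" "r = 1" | (bbb) "b = 3" "r = 0"
      by linarith
    then show ?thesis
    proof cases
      case only_r
      then show ?thesis using \<open>a = 0\<close> few[of 3] loss_rrr by simp
    next
      case one_b
      then show ?thesis using \<open>a = 0\<close> few[of 2] loss_brr by simp
    qed (use \<open>a = 0\<close> loss_bb loss_bbr loss_bbb in auto)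
  next
    case only_a
    show ?thesis
    proof (cases "r = 2")
      case False
      then have "r \<le> 1" using only_a by simp
      then show ?thesis using only_a few[of 1] loss_ar by simp
    qed (use only_a loss_arr in auto)
  qed (use loss_ab loss_aa in auto)
qed

lemma sum_ge_if_slots:
  fixes v W :: "'a \<Rightarrow> real" and \<alpha> \<beta> \<gamma> la lb lr e t :: real
  assumes "finite S" and disjoint: "X \<inter> Y = {}" "X \<inter> Z = {}" "Y \<inter> Z = {}"
    and X: "\<And>g. g \<in> S \<Longrightarrow> g \<in> X \<Longrightarrow> \<alpha> \<le> W g \<and> e * v g - la \<le> W g"
    and Y: "\<And>g. g \<in> S \<Longrightarrow> g \<in> Y \<Longrightarrow> \<beta> \<le> W g \<and> e * v g - lb \<le> W g"
    and Z: "\<And>g. g \<in> S \<Longrightarrow> g \<in> Z \<Longrightarrow> \<gamma> \<le> W g \<and> e * v g - lr \<le> W g"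
    and rest: "\<And>g. g \<in> S \<Longrightarrow> g \<notin> X \<union> Y \<union> Z \<Longrightarrow> 0 \<le> W g \<and> e * v g \<le> W g"
    and slots: "\<And>(a::nat) (b::nat) (r::nat).
      t \<le> a * \<alpha> + b * \<beta> + r * \<gamma> \<or> a * la + b * lb + r * lr \<le> e * sum v S - t"
  shows "t \<le> sum W S"
proof -
  define f where "f x y z g = (if g \<in> X then x else 0) + (if g \<in> Y then y else 0) +
    (if g \<in> Z then z else 0)" for x y z :: real and g
  have sum_f: "sum (f x y z) S = card (S \<inter> X) * x + card (S \<inter> Y) * y + card (S \<inter> Z) * z"
    for x y z :: real
    using \<open>finite S\<close> by (simp add: f_def sum.distrib flip: sum.inter_restrict)
  have "sum (f \<alpha> \<beta> \<gamma>) S \<le> sum W S"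
    by (rule sum_mono) (use disjoint X Y Z rest in \<open>force simp: f_def\<close>)
  moreover have "(\<Sum>g\<in>S. e * v g - f la lb lr g) \<le> sum W S"
    by (rule sum_mono) (use disjoint X Y Z rest in \<open>force simp: f_def\<close>)
  then have "e * sum v S - sum (f la lb lr) S \<le> sum W S"
    by (simp add: sum_subtractf sum_distrib_left)
  ultimately show ?thesis
    using slots[of "card (S \<inter> X)" "card (S \<inter> Y)" "card (S \<inter> Z)"] sum_f[of \<alpha> \<beta> \<gamma>] sum_f[of la lb lr]
    by argo
qed

text \<open>A bundle of value 1 has to get weight 4. The weight per unit of value exceeds 4 by the factor
  \<open>1 + 57/1000\<close>, which pays for the losses.\<close>

abbreviation rate :: real where
  "rate \<equiv> 1057/250"

text \<open>\<open>U\<close> and \<open>L\<close> bound the two goods of the critical pairs, those whose value lies just below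
  the threshold. Weights proportional to value would be wasteful there, so the goods of critical
  pairs get constant weights \<open>\<alpha>\<close> and \<open>\<beta>\<close> that leave exactly \<open>\<gamma>\<close> for a third good;
  \<open>\<rho>\<close> bounds the loss of any other good.\<close>

locale slot_weights =
  fixes d U L \<alpha> \<beta> \<gamma> \<rho> :: real
  assumes gamma_ge: "1 \<le> \<gamma>" and gamma_le: "\<gamma> \<le> 1 + 4 * d / 3"
    and slot_sum: "\<alpha> + \<beta> + \<gamma> = 4"
    and loss_ge: "rate / 4 * (1 + 4 * d / 3) - \<gamma> \<le> \<rho>" "(rate / 4 - 1) * (1 - 4 * d) \<le> \<rho>"
    and slots: "\<And>(a::nat) (b::nat) (r::nat). 4 \<le> a * \<alpha> + b * \<beta> + r * \<gamma> \<or>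
       a * (rate * U - \<alpha>) + b * (rate * L - \<beta>) + r * \<rho> \<le> rate - 4"

text \<open>The constants interpolate between the shapes (1/2, 1/4, 1/4) and (3/8, 3/8, 1/4) of a bundle.\<close>

lemma ex_slot_weights:
  fixes U L d :: real
  assumes d_bounds: "0 \<le> d" "d \<le> 3/956"
    and pair_bounds: "U + L \<le> 3/4 + d" "U \<le> 1/2 + 2 * d" "L \<le> 3/8 + d / 2"
  obtains \<alpha> \<beta> \<gamma> \<rho> where "slot_weights d U L \<alpha> \<beta> \<gamma> \<rho>"
proof -
  define h where "h = 1/2 - U"
  have U_eq: "U = 1/2 - h" by (simp add: h_def)
  consider (small) "h \<le> 0" | (middle) "0 \<le> h" "h \<le> 2 * d / 3" | (large) "2 * d / 3 \<le> h" by linarith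
  then show ?thesis
  proof cases
    case small
    have "slot_weights d U L 2 1 1 (rate / 4 * (1 + 4 * d / 3) - 1)"
    proof (unfold_locales, goal_cases)
      case (6 a b r)
      then show ?case by (insert assms small U_eq, rule slot_weight_ge_or_loss_le) argo+
    qed (use d_bounds in argo)+
    then show ?thesis by (rule that)
  next
    case middle
    have "slot_weights d U L (2 - 4 * h) (1 + 2 * h) (1 + 2 * h) (rate / 4 * (1 + 4 * d / 3) - 1)"
    proof (unfold_locales, goal_cases)
      case (6 a b r)
      then show ?case by (insert assms middle U_eq, rule slot_weight_ge_or_loss_le) argo+
    qed (use d_bounds middle in argo)+
    then show ?thesis by (rule that)
  next
    case large
    define x y where "x = (3 - 4 * d / 3) / 2"
      and "y = 1 - 4 * d / 3 + rate * h - (rate / 4 - 1) * (8 * d / 3)"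
    define \<beta> where "\<beta> = min x y"
    have beta_min: "\<beta> = x \<or> \<beta> = y" "\<beta> \<le> x" "\<beta> \<le> y" by (auto simp: \<beta>_def min_def)
    have "slot_weights d U L (3 - 4 * d / 3 - \<beta>) \<beta> (1 + 4 * d / 3)
      ((rate / 4 - 1) * (1 + 4 * d / 3))"
    proof (unfold_locales, goal_cases)
      case (6 a b r)
      then show ?case
        by (insert assms large U_eq beta_min x_def y_def, rule slot_weight_ge_or_loss_le) argo+
    qed (use d_bounds in argo)+
    then show ?thesis by (rule that)
  qed
qed

section \<open>Agents in an irreducible instance\<close>

lemma card_block: "1 \<le> n \<Longrightarrow> card {j * (n - 1)..j * n} = Suc j" for n :: nat
  by (cases n) auto

lemma mult_le_sum_block:
  fixes u :: "nat \<Rightarrow> real"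
  assumes "antimono u" "1 \<le> n"
  shows "(real j + 1) * u (j * n) \<le> sum u {j * (n - 1)..j * n}"
  using sum_bounded_below[of "{j * (n - 1)..j * n}" "u (j * n)" u, unfolded card_block[OF assms(2)]]
    antimonoD[OF assms(1)] by (simp add: add.commute)

locale normalised_agent =
  fixes n m :: nat and w :: "nat \<Rightarrow> real" and \<pi> :: "nat \<Rightarrow> nat" and J :: "nat set"
  assumes finite_labels: "finite J" and card_labels: "card J = n" and labels: "\<pi> ` {..<m} \<subseteq> J"
    and bundle_value: "j \<in> J \<Longrightarrow> sum w {g \<in> {..<m}. \<pi> g = j} = 1"
    and decreasing: "antimono w" and nonneg: "0 \<le> w g"
begin

lemma anti: "i \<le> j \<Longrightarrow> w j \<le> w i"
  by (rule antimonoD[OF decreasing])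

lemma sum_goods_ge:
  fixes f :: "nat \<Rightarrow> real" and x :: real
  assumes "\<And>j. j \<in> J \<Longrightarrow> x \<le> sum f {g \<in> {..<m}. \<pi> g = j}"
  shows "n * x \<le> sum f {..<m}"
  using card_mult_le_sum_fibres[OF finite_lessThan finite_labels labels assms] card_labels by simp

lemma total_ge: "n \<le> sum w {..<m}"
  using sum_goods_ge[of 1 w] bundle_value by simp

end

locale irreducible_agent = normalised_agent +
  fixes d :: real
  assumes n_pos: "1 \<le> n" and m_large: "3 * n < m" and d_nonneg: "0 \<le> d"
    and block_less: "j \<le> 3 \<Longrightarrow> sum w {j * (n - 1)..j * n} < 3/4 + d"
    and pair_less: "w 0 + w (2 * n) < 3/4 + d"
begin

lemma value_mult: "j \<le> 3 \<Longrightarrow> (real j + 1) * w (j * n) < 3/4 + d"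
  using mult_le_sum_block[OF decreasing n_pos, of j] block_less[of j] by linarith

lemma value_n: "w n < 3/8 + d / 2"
  using value_mult[of 1] by simp

lemma value_2n: "w (2 * n) < 1/4 + d / 3"
  using value_mult[of 2] by simp

lemma value_3n: "w (3 * n) < 3/16 + d / 4"
  using value_mult[of 3] by simp

end

definition mirrored_pair :: "nat \<Rightarrow> nat \<Rightarrow> nat set" where
  "mirrored_pair n k = {k, 2 * n - 1 - k}"

definition shifted_pair :: "nat \<Rightarrow> nat \<Rightarrow> nat set" where
  "shifted_pair n k = {k, n + k}"

lemma initial_bags_mirrored: "initial_bags n (2 * n) (mirrored_pair n)"
proof
  show "disjoint_family_on (mirrored_pair n) {..<n}"
    by (auto simp: disjoint_family_on_def mirrored_pair_def)
  have "g \<in> (\<Union>k<n. mirrored_pair n k)" if "g < 2 * n" for g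
    using that by (cases "g < n") (auto simp: mirrored_pair_def intro: bexI[of _ "2 * n - 1 - g"])
  then show "(\<Union>k<n. mirrored_pair n k) = {..<2 * n}" by (auto simp: mirrored_pair_def)
qed

lemma initial_bags_shifted: "initial_bags n (2 * n) (shifted_pair n)"
proof
  show "disjoint_family_on (shifted_pair n) {..<n}"
    by (auto simp: disjoint_family_on_def shifted_pair_def)
  have "g \<in> (\<Union>k<n. shifted_pair n k)" if "g < 2 * n" for g
    using that by (cases "g < n") (auto simp: shifted_pair_def intro: bexI[of _ "g - n"])
  then show "(\<Union>k<n. shifted_pair n k) = {..<2 * n}" by (auto simp: shifted_pair_def)
qed

lemma sum_mirrored_pair:
  fixes f :: "nat \<Rightarrow> real"
  assumes "k < n"
  shows "sum f (mirrored_pair n k) = f k + f (2 * n - 1 - k)"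
proof -
  have "k \<noteq> 2 * n - 1 - k" using assms by linarith
  then show ?thesis by (simp add: mirrored_pair_def)
qed

lemma sum_shifted_pair:
  fixes f :: "nat \<Rightarrow> real"
  assumes "k < n"
  shows "sum f (shifted_pair n k) = f k + f (n + k)"
  using assms by (simp add: shifted_pair_def)

locale stuck_agent =
  irreducible_agent n m w \<pi> J d + stuck_bags n "2 * n" B m "3/4 + d" w c s
  for n m w \<pi> J d B c s
begin

lemma bag_unfilled: "\<not> c k < c (Suc k) \<Longrightarrow> bag B c k = B k"
  by (simp add: bag_def)

lemma filled_bag_less:
  assumes "k < n" "c k < c (Suc k)"
  shows "sum w (bag B c k) < 3/4 + d + w (2 * n)"
proof -
  let ?g = "c (Suc k) - 1"
  have "2 * n \<le> ?g" using cutoff_ge_l[of k] assms(2) by simp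
  then have "w ?g \<le> w (2 * n)" by (rule anti)
  moreover have "sum w {c k..<c (Suc k)} = sum w {c k..<?g} + w ?g"
    using assms(2) sum.atLeastLessThan_Suc[of "c k" ?g w] by simp
  moreover have "sum w (B k \<union> {c k..<?g}) = sum w (B k) + sum w {c k..<?g}"
    using assms(1) by (rule sum_bag[OF cutoff_mono cutoff_0])
  ultimately show ?thesis
    using before_last_less[OF assms(2) nonneg] sum_bag_eq[OF assms(1), of w] by simp
qed

lemma no_separating_weights:
  fixes f :: "nat \<Rightarrow> real"
  assumes "\<And>j. j \<in> J \<Longrightarrow> x \<le> sum f {g \<in> {..<m}. \<pi> g = j}"
    and "\<And>k. k < n \<Longrightarrow> sum f (bag B c k) \<le> x" "sum f (bag B c s) < x"
  shows False
  using sum_goods_ge[OF assms(1)] sum_goods_less[OF assms(2,3)] by simp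

lemma initial_bag_gt_1:
  assumes "w (2 * n) \<le> 1/4 - d" "d < 1/4"
  obtains k where "k < n" "1 < sum w (B k)"
proof (rule ccontr)
  assume "\<not> thesis"
  then have initial_le: "\<forall>k<n. sum w (B k) \<le> 1" using that not_less by blast
  show False
  proof (rule no_separating_weights[of 1 w])
    show "sum w (bag B c k) \<le> 1" if "k < n" for k
      using filled_bag_less[OF that] bag_unfilled[of k] initial_le that assms(1)
      by (cases "c k < c (Suc k)") auto
  qed (use bundle_value stuck_value assms(2) in auto)
qed

lemma le_two_level_bags:
  fixes hi lo :: real
  assumes outside_S: "S \<subseteq> {..<s}" "\<And>k. k < s \<Longrightarrow> k \<notin> S \<Longrightarrow> sum w (bag B c k) < 3/4 + d"
    and hi_ge: "1 + 4 * d / 3 \<le> hi" "\<And>k. k < n \<Longrightarrow> sum w (B k) \<le> hi"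
    and lo_ge: "3/4 + d \<le> lo" "\<And>k. s < k \<Longrightarrow> k < n \<Longrightarrow> sum w (B k) \<le> lo"
  shows "n \<le> card S * hi + (real n - card S) * lo"
proof -
  have "S \<subseteq> {..<n}" using outside_S(1) stuck_less by auto
  have bag_le_lo: "sum w (bag B c k) \<le> lo" if "k < n" "k \<notin> S" for k
  proof -
    consider (filled) "k < s" | (stuck) "k = s" | (unfilled) "s < k" by linarith
    then show ?thesis
    proof cases
      case unfilled
      then show ?thesis using bag_unfilled[of k] cutoff_after[of k] cutoff_after[of "Suc k"]
        lo_ge(2) that by simp
    qed (use outside_S(2)[of k] that stuck_value lo_ge(1) in auto)
  qed
  have bag_le_hi: "sum w (bag B c k) \<le> hi" if "k < n" for k
    using filled_bag_less[OF that] bag_unfilled[of k] value_2n hi_ge that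
    by (cases "c k < c (Suc k)") force+
  have "n \<le> (\<Sum>k<n. sum w (bag B c k))" using total_ge by (simp add: sum_goods_eq)
  also have "\<dots> = (\<Sum>k\<in>S. sum w (bag B c k)) + (\<Sum>k\<in>{..<n} - S. sum w (bag B c k))"
    using sum.subset_diff[OF \<open>S \<subseteq> {..<n}\<close>] by (simp add: add.commute)
  also have "\<dots> \<le> (\<Sum>k\<in>S. hi) + (\<Sum>k\<in>{..<n} - S. lo)"
    using bag_le_lo bag_le_hi \<open>S \<subseteq> {..<n}\<close> by (intro add_mono sum_mono) auto
  finally show ?thesis
    using \<open>S \<subseteq> {..<n}\<close> card_mono[OF _ \<open>S \<subseteq> {..<n}\<close>]
    by (simp add: card_Diff_subset finite_subset of_nat_diff)
qed

end

subsection \<open>Precedence\<close>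

context irreducible_agent
begin

lemma no_stuck_mirrored_precedence:
  assumes tight: "1/4 - d < w (2 * n)" and d_small: "52 * d < 1"
    and stuck: "stuck_bags n (2 * n) (mirrored_pair n) m (3/4 + d) w c s"
    and precedence: "S \<subseteq> {..<s}" "4 * card S \<le> 3 * n"
      "\<And>k. k < s \<Longrightarrow> k \<notin> S \<Longrightarrow> sum w (bag (mirrored_pair n) c k) < 3/4 + d"
  shows False
proof -
  interpret stuck_bags n "2 * n" "mirrored_pair n" m "3/4 + d" w c s by (rule stuck)
  interpret stuck_agent n m w \<pi> J d "mirrored_pair n" c s by unfold_locales
  have pair_le_lo: "sum w (mirrored_pair n k) \<le> 7/8 + 5 * d / 2" if "k < n" for k
  proof -
    have "w (2 * n - 1 - k) \<le> w n" using that by (intro anti) simp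
    then show ?thesis using sum_mirrored_pair[OF that, of w] tight pair_less value_n anti[of 0 k]
      by simp
  qed
  have lo_le_hi: "7/8 + 5 * d / 2 \<le> 1 + 4 * d / 3" using d_small by simp
  have "n \<le> card S * (1 + 4 * d / 3) + (real n - card S) * (7/8 + 5 * d / 2)"
    by (rule le_two_level_bags[OF precedence(1,3)])
      (use pair_le_lo order_trans[OF pair_le_lo lo_le_hi] d_nonneg in auto)
  also have "\<dots> < n"
  proof -
    have "card S * (1/8 - 7 * d / 6) \<le> 3 * real n / 4 * (1/8 - 7 * d / 6)"
      using precedence(2) d_small by (intro mult_right_mono) auto
    moreover have "n * (52 * d) < n" using n_pos d_small by simp
    ultimately show ?thesis by argo
  qed
  finally show False by simp
qed

lemma no_stuck_shifted_precedence:
  assumes d_small: "36 * d < 5"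
    and stuck: "stuck_bags n (2 * n) (shifted_pair n) m (3/4 + d) w c s"
    and precedence: "S \<subseteq> {..<s}" "4 * card S < n"
      "\<And>k. k < s \<Longrightarrow> k \<notin> S \<Longrightarrow> sum w (bag (shifted_pair n) c k) < 3/4 + d"
  shows False
proof -
  interpret stuck_bags n "2 * n" "shifted_pair n" m "3/4 + d" w c s by (rule stuck)
  interpret stuck_agent n m w \<pi> J d "shifted_pair n" c s by unfold_locales
  have pair_le_hi: "sum w (shifted_pair n k) \<le> 9/8 + 3 * d / 2" if "k < n" for k
    using sum_shifted_pair[OF that, of w] pair_less nonneg[of "2 * n"] value_n anti[of 0 k]
      anti[of n "n + k"] that by simp
  have pair_s: "sum w (shifted_pair n s) < 3/4 + d"
    using stuck_value sum_bag_eq[OF stuck_less, of w] sum_nonneg[of "{c s..<c (Suc s)}" w] nonneg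
    by fastforce
  have pair_le_lo: "sum w (shifted_pair n k) \<le> 3/4 + d" if "s < k" "k < n" for k
    using pair_s sum_shifted_pair[OF that(2), of w] sum_shifted_pair[OF stuck_less, of w]
      anti[of s k] anti[of "n + s" "n + k"] that by simp
  have "n \<le> card S * (9/8 + 3 * d / 2) + (real n - card S) * (3/4 + d)"
    by (rule le_two_level_bags[OF precedence(1,3)])
      (use pair_le_hi pair_le_lo d_small d_nonneg in auto)
  also have "\<dots> < n"
  proof -
    have "card S * (3/8 + d / 2) \<le> n / 4 * (3/8 + d / 2)"
      using precedence(2) d_nonneg by (intro mult_right_mono) auto
    moreover have "real n * (36 * d) < real n * 5" using n_pos d_small by simp
    ultimately show ?thesis by argo
  qed
  finally show False by simp
qed

end

subsection \<open>Mirrored pairs\<close>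

locale oversized_pair = irreducible_agent +
  fixes L :: nat
  assumes L_less: "L < n" and oversized: "1 < w L + w (2 * n - 1 - L)" and d_small: "36 * d \<le> 1"
begin

abbreviation partner_value :: real where
  "partner_value \<equiv> w (2 * n - 1 - L)"

lemma large_greater: "g \<le> L \<Longrightarrow> 1 - partner_value < w g"
  using oversized anti[of g L] by simp

lemma partner_value_le: "g \<le> 2 * n - 1 - L \<Longrightarrow> partner_value \<le> w g"
  by (rule anti)

lemma large_alone:
  assumes "g \<le> L" "h \<le> 2 * n - 1 - L" "\<pi> h = \<pi> g"
  shows "h = g"
proof (rule ccontr)
  assume "h \<noteq> g"
  have goods: "g < m" "h < m" using assms(1,2) L_less m_large by auto
  have "w g + w h = sum w {g, h}" using \<open>h \<noteq> g\<close> by simp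
  also have "\<dots> \<le> sum w {x \<in> {..<m}. \<pi> x = \<pi> g}"
    by (rule sum_mono2) (use goods assms(3) nonneg in auto)
  also have "\<dots> = 1" using goods(1) labels by (intro bundle_value) auto
  finally show False using large_greater[OF assms(1)] partner_value_le[OF assms(2)] by simp
qed

text \<open>Counting the goods \<open>g \<le> L\<close> twice, there are \<open>2n + 1\<close> goods up to \<open>2n - 1 - L\<close>, so
  some bundle has three of them; it cannot contain a good \<open>g \<le> L\<close>.\<close>

lemma partner_value_le_third: "partner_value \<le> 1/3"
proof -
  define \<kappa> :: "nat \<Rightarrow> real" where "\<kappa> g = of_bool (g \<in> {..L}) + of_bool (g \<in> {..2 * n - 1 - L})" for g
  have sum_\<kappa>: "sum \<kappa> A = real (card (A \<inter> {..L})) + real (card (A \<inter> {..2 * n - 1 - L}))"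
    if "finite A" for A
    using that by (simp add: \<kappa>_def sum.distrib Int_def)
  have "{..<m} \<inter> {..L} = {..L}" "{..<m} \<inter> {..2 * n - 1 - L} = {..2 * n - 1 - L}"
    using L_less m_large by auto
  then have "sum \<kappa> {..<m} = 2 * real n + 1" using sum_\<kappa>[of "{..<m}"] L_less
    by (simp add: of_nat_diff)
  then have "real (card J) * 2 < sum \<kappa> {..<m}" using card_labels by simp
  then obtain j where label: "j \<in> J" and "2 < sum \<kappa> {g \<in> {..<m}. \<pi> g = j}"
    by (rule pigeonhole_sum_fibres[OF finite_lessThan finite_labels labels])
  then have \<kappa>: "2 < card ({g \<in> {..<m}. \<pi> g = j} \<inter> {..L}) +
      card ({g \<in> {..<m}. \<pi> g = j} \<inter> {..2 * n - 1 - L})"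
    (is "2 < card (?S \<inter> _) + card ?X") by (simp add: sum_\<kappa> flip: of_nat_add)
  have "?S \<inter> {..L} = {}"
  proof (rule ccontr)
    assume "?S \<inter> {..L} \<noteq> {}"
    then obtain g where large_good: "g \<le> L" "\<pi> g = j" by auto
    then have "?S \<inter> {..L} \<subseteq> {g}" "?X \<subseteq> {g}" using large_alone[of g] L_less by auto
    then have "card (?S \<inter> {..L}) \<le> 1" "card ?X \<le> 1" using card_mono[of "{g}"] by auto
    with \<kappa> show False by simp
  qed
  then have "3 * partner_value \<le> card ?X * partner_value" using \<kappa>
    by (intro mult_right_mono nonneg) auto
  also have "\<dots> \<le> sum w ?X" by (rule sum_bounded_below) (use partner_value_le in auto)
  also have "\<dots> \<le> sum w ?S" by (rule sum_mono2) (auto simp: nonneg)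
  finally show ?thesis using bundle_value[OF label] by simp
qed

lemma two_thirds_less: "g \<le> L \<Longrightarrow> 2/3 < w g"
  using large_greater[of g] partner_value_le_third by simp

lemma value_2n_less: "w (2 * n) < 1/12 + d"
  using two_thirds_less[of 0] pair_less by simp

lemma partner_value_greater: "1/4 - d + w (2 * n) < partner_value"
  using large_greater[of 0] pair_less by simp

definition discount :: real where
  "discount = 3/2 * (1/4 - d + w (2 * n))"

lemma discount_ge: "1/3 \<le> discount"
  using nonneg[of "2 * n"] d_small by (simp add: discount_def)

text \<open>A bundle has at most one good \<open>g \<le> L\<close>, and the rest of such a bundle is worth at least
  \<open>2/3 * discount\<close>, so its weight is at least \<open>discount\<close>.\<close>

definition weight :: "nat \<Rightarrow> real" where
  "weight g = (if g \<le> L then 1 - discount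
    else if g < 2 * n - 1 - L then w g else min discount (3/2 * w g))"

lemma value_le_weight:
  assumes "L < g"
  shows "w g \<le> weight g"
proof (cases "g < 2 * n - 1 - L")
  case True
  then show ?thesis using assms by (simp add: weight_def)
next
  case False
  then have "w g \<le> partner_value" by (intro anti) simp
  then show ?thesis using assms False partner_value_le_third discount_ge nonneg[of g]
    by (auto simp: weight_def)
qed

lemma weight_nonneg: "L < g \<Longrightarrow> 0 \<le> weight g"
  using value_le_weight[of g] nonneg[of g] by simp

lemma discount_le_weight_rest:
  assumes large_b: "b \<le> L" "\<pi> b = j" and label: "j \<in> J"
  shows "discount \<le> sum weight ({g \<in> {..<m}. \<pi> g = j} - {b})" (is "discount \<le> sum weight ?R")
proof -
  have b_in_bundle: "b \<in> {g \<in> {..<m}. \<pi> g = j}" using large_b L_less m_large by simp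
  have far: "2 * n - 1 - L < g" if "g \<in> ?R" for g
    using large_alone[OF large_b(1), of g] large_b(2) that by (cases "g \<le> 2 * n - 1 - L") auto
  then have rest: "2 * n - 1 - L < g" "L < g" if "g \<in> ?R" for g using that L_less by fastforce+
  have sum_rest: "sum w ?R = 1 - w b"
    using bundle_value[OF label] sum.remove[OF _ b_in_bundle, of w] by simp
  show ?thesis
  proof (cases "\<exists>g\<in>?R. discount \<le> 3/2 * w g")
    case True
    then obtain g where valuable: "g \<in> ?R" "discount \<le> 3/2 * w g" by blast
    then have "discount = weight g" using rest[of g] by (simp add: weight_def)
    also have "\<dots> \<le> sum weight ?R" by (rule member_le_sum) (use valuable rest weight_nonneg in auto)
    finally show ?thesis .
  next
    case False
    have "sum weight ?R = (\<Sum>g\<in>?R. 3/2 * w g)"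
    proof (rule sum.cong)
      fix g assume in_rest: "g \<in> ?R"
      then have "3/2 * w g < discount" using False not_le by blast
      then show "weight g = 3/2 * w g" using rest[OF in_rest] by (simp add: weight_def)
    qed simp
    also have "\<dots> = 3/2 * (1 - w b)" unfolding sum_rest[symmetric]
      by (rule sum_distrib_left[symmetric])
    finally show ?thesis using anti[of 0 b] pair_less by (simp add: discount_def)
  qed
qed

lemma bundle_weight_ge_1:
  assumes label: "j \<in> J"
  shows "1 \<le> sum weight {g \<in> {..<m}. \<pi> g = j}" (is "1 \<le> sum weight ?S")
proof (cases "\<exists>b\<le>L. \<pi> b = j")
  case True
  then obtain b where large_b: "b \<le> L" "\<pi> b = j" by blast
  then have "b \<in> ?S" using L_less m_large by simp
  then have "sum weight ?S = weight b + sum weight (?S - {b})" by (intro sum.remove) auto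
  then show ?thesis using discount_le_weight_rest[OF large_b label] large_b(1)
    by (simp add: weight_def)
next
  case False
  have "1 = sum w ?S" using bundle_value[OF label] by simp
  also have "\<dots> \<le> sum weight ?S" by (rule sum_mono) (use False value_le_weight not_le in blast)
  finally show ?thesis .
qed

lemma weight_mirrored_pair:
  assumes "k < n"
  shows "sum weight (mirrored_pair n k) =
    (if k \<le> L then 1 - discount + min discount (3/2 * w (2 * n - 1 - k))
     else sum w (mirrored_pair n k))"
proof -
  have "\<not> 2 * n - 1 - k \<le> L" using assms L_less by simp
  moreover have "k < 2 * n - 1 - L" using assms L_less by simp
  moreover have "2 * n - 1 - k < 2 * n - 1 - L \<longleftrightarrow> L < k" using assms L_less by auto
  ultimately show ?thesis using assms unfolding weight_def sum_mirrored_pair[OF assms] by simp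
qed

lemma filled_bag_weight_less_1:
  assumes bag_number: "k < n" and filling: "2 * n \<le> a"
    and worth: "sum w (mirrored_pair n k) + sum w {a..<b} < 3/4 + d + w (2 * n)"
  shows "sum weight (mirrored_pair n k) + sum weight {a..<b} < 1"
proof -
  have weight_filling: "sum weight {a..<b} \<le> 3/2 * sum w {a..<b}"
    unfolding sum_distrib_left by (rule sum_mono) (use filling L_less in \<open>auto simp: weight_def\<close>)
  show ?thesis
  proof (cases "k \<le> L")
    case True
    have "sum weight (mirrored_pair n k) \<le> 1 - discount + 3/2 * w (2 * n - 1 - k)"
      using weight_mirrored_pair[OF bag_number] True by simp
    then show ?thesis
      using weight_filling worth two_thirds_less[OF True] d_small
      unfolding sum_mirrored_pair[OF bag_number] discount_def by argo
  next
    case False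
    have "partner_value \<le> w k" "partner_value \<le> w (2 * n - 1 - k)"
      by (intro partner_value_le; use False bag_number L_less in simp)+
    then have "2 * partner_value \<le> sum w (mirrored_pair n k)"
      by (simp add: sum_mirrored_pair[OF bag_number])
    then show ?thesis
      using weight_mirrored_pair[OF bag_number] False weight_filling worth value_2n_less
        partner_value_greater d_small by simp
  qed
qed

end

context irreducible_agent
begin

lemma no_stuck_mirrored:
  assumes loose: "w (2 * n) \<le> 1/4 - d" and d_small: "36 * d \<le> 1"
    and stuck: "stuck_bags n (2 * n) (mirrored_pair n) m (3/4 + d) w c s"
  shows False
proof -
  interpret stuck_bags n "2 * n" "mirrored_pair n" m "3/4 + d" w c s by (rule stuck)
  interpret stuck_agent n m w \<pi> J d "mirrored_pair n" c s by unfold_locales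
  let ?big = "{k. k < n \<and> 1 < sum w (mirrored_pair n k)}"
  define L where "L = Max ?big"
  obtain k where "k \<in> ?big" using initial_bag_gt_1[OF loose] d_small by auto
  then have "L \<in> ?big" unfolding L_def by (intro Max_in) auto
  then interpret oversized_pair n m w \<pi> J d L
    using d_small sum_mirrored_pair[of L n w] by unfold_locales auto
  have filled: "sum weight (bag (mirrored_pair n) c k) < 1"
    if "k < n" "sum w (bag (mirrored_pair n) c k) < 3/4 + d + w (2 * n)" for k
    using filled_bag_weight_less_1[OF that(1) cutoff_ge_l[of k]] that(2)
    by (simp add: sum_bag_eq[OF that(1)])
  have pair_le: "sum weight (mirrored_pair n k) \<le> 1" if "k < n" for k
  proof (cases "k \<le> L")
    case False
    then have "k \<notin> ?big" unfolding L_def using Max_ge[of ?big k] by auto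
    then show ?thesis using weight_mirrored_pair[OF that] False that by simp
  qed (use weight_mirrored_pair[OF that] in simp)
  show False
  proof (rule no_separating_weights[OF bundle_weight_ge_1])
    show "sum weight (bag (mirrored_pair n) c k) \<le> 1" if "k < n" for k
      using filled[OF that] filled_bag_less[OF that] bag_unfilled[of k] pair_le[OF that]
      by (cases "c k < c (Suc k)") auto
    show "sum weight (bag (mirrored_pair n) c s) < 1"
      using filled[OF stuck_less] stuck_value nonneg[of "2 * n"] by simp
  qed
qed

end

subsection \<open>Shifted pairs\<close>

context irreducible_agent
begin

definition critical :: "nat \<Rightarrow> bool" where
  "critical k \<longleftrightarrow> 29/40 \<le> w k + w (n + k) \<and> w k + w (n + k) < 3/4 + d"

lemma ex_critical_bounds:
  assumes tight: "1/4 - d < w (2 * n)"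
  obtains U L where "U + L \<le> 3/4 + d" "U \<le> 1/2 + 2 * d" "L \<le> 3/8 + d / 2"
    "\<And>k. critical k \<Longrightarrow> w k \<le> U \<and> w (n + k) \<le> L"
proof (cases "\<exists>k. critical k")
  case True
  define k where "k = (LEAST k. critical k)"
  have first_critical: "critical k" unfolding k_def using True by (rule LeastI_ex)
  show ?thesis
  proof (rule that[of "w k" "w (n + k)"])
    show "w k + w (n + k) \<le> 3/4 + d" using first_critical by (simp add: critical_def)
    show "w k \<le> 1/2 + 2 * d" using anti[of 0 k] pair_less tight by simp
    show "w (n + k) \<le> 3/8 + d / 2" using anti[of n "n + k"] value_n by simp
    show "w i \<le> w k \<and> w (n + i) \<le> w (n + k)" if "critical i" for i
      using Least_le[of critical i] that by (simp add: anti flip: k_def)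
  qed
next
  case False
  then show ?thesis using d_nonneg by (intro that[of "1/2" "1/4"]) auto
qed

end

locale tight_agent = irreducible_agent n m w \<pi> J d + slot_weights d U L \<alpha> \<beta> \<gamma> \<rho>
  for n m w \<pi> J d U L \<alpha> \<beta> \<gamma> \<rho> +
  assumes tight: "1/4 - d < w (2 * n)" and d_le: "d \<le> 3/956"
    and critical_le: "critical k \<Longrightarrow> w k \<le> U \<and> w (n + k) \<le> L"
begin

definition plain_weight :: "real \<Rightarrow> real" where
  "plain_weight x = max \<gamma> (rate * x - (rate / 4 - 1) * (1 - 4 * d))"

definition weight :: "nat \<Rightarrow> real" where
  "weight g =
    (if g < n then if critical g then \<alpha> else plain_weight (w g)
     else if g < 2 * n then if critical (g - n) then \<beta> else plain_weight (w g)
     else if g < 3 * n then min \<gamma> (rate * w g) else rate * w g)"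

text \<open>There are exactly \<open>n\<close> goods in \<open>{2n..<3n}\<close>, hence one per bag on average: charging
  \<open>12/125\<close> for each of them gives slack to the bags that contain at least two.\<close>

definition charged :: "nat \<Rightarrow> real" where
  "charged g = weight g - (if 2 * n \<le> g \<and> g < 3 * n then 12/125 else 0)"

lemma bundle_weight_ge_4:
  assumes "j \<in> J"
  shows "4 \<le> sum weight {g \<in> {..<m}. \<pi> g = j}"
proof (rule sum_ge_if_slots)
  let ?X = "{g. g < n \<and> critical g}" and ?Y = "{g. n \<le> g \<and> g < 2 * n \<and> critical (g - n)}"
  let ?Z = "{g. g < 2 * n} - ?X - ?Y \<union> {g. 2 * n \<le> g \<and> g < 3 * n \<and> \<gamma> \<le> rate * w g}"
  show "?X \<inter> ?Y = {}" "?X \<inter> ?Z = {}" "?Y \<inter> ?Z = {}" by auto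
  show "\<alpha> \<le> weight g \<and> rate * w g - (rate * U - \<alpha>) \<le> weight g" if "g \<in> ?X" for g
    using that critical_le[of g] by (simp add: weight_def)
  show "\<beta> \<le> weight g \<and> rate * w g - (rate * L - \<beta>) \<le> weight g" if "g \<in> ?Y" for g
    using that critical_le[of "g - n"] by (simp add: weight_def)
  show "\<gamma> \<le> weight g \<and> rate * w g - \<rho> \<le> weight g" if "g \<in> ?Z" for g
  proof (cases "g < 2 * n")
    case True
    then have "weight g = plain_weight (w g)" using that by (auto simp: weight_def)
    then show ?thesis using loss_ge(2) by (simp add: plain_weight_def max_def) argo
  next
    case False
    then have "weight g = \<gamma>" using that by (auto simp: weight_def)
    moreover have "w g \<le> 1/4 + d / 3" using False anti[of "2 * n" g] value_2n by simp
    ultimately show ?thesis using loss_ge(1) by argo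
  qed
  show "0 \<le> weight g \<and> rate * w g \<le> weight g" if "g \<notin> ?X \<union> ?Y \<union> ?Z" for g
    using that nonneg[of g] gamma_ge by (auto simp: weight_def)
  show "4 \<le> a * \<alpha> + b * \<beta> + r * \<gamma> \<or> a * (rate * U - \<alpha>) + b * (rate * L - \<beta>) + r * \<rho> \<le>
      rate * sum w {g \<in> {..<m}. \<pi> g = j} - 4" for a b r :: nat
    using slots[of a b r] bundle_value[OF assms] by simp
qed simp

lemma sum_charged_goods_ge: "n * (4 - 12/125) \<le> sum charged {..<m}"
proof -
  have "{..<m} \<inter> {g. 2 * n \<le> g \<and> g < 3 * n} = {2 * n..<3 * n}" using m_large by auto
  then have "sum charged {..<m} = sum weight {..<m} - 12/125 * n"
    unfolding charged_def sum_subtractf by (simp add: sum.If_cases)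
  then show ?thesis using sum_goods_ge[of 4 weight] bundle_weight_ge_4 by (simp add: algebra_simps)
qed

lemma charged_le_rate: "2 * n \<le> g \<Longrightarrow> charged g \<le> rate * w g - (if g < 3 * n then 12/125 else 0)"
  by (auto simp: charged_def weight_def min_def)

lemma charged_le_gamma: "2 * n \<le> g \<Longrightarrow> g < 3 * n \<Longrightarrow> charged g \<le> \<gamma> - 12/125"
  by (simp add: charged_def weight_def)

lemma sum_charged_le_rate:
  assumes "2 * n \<le> a"
  shows "sum charged {a..<b} \<le> rate * sum w {a..<b}"
  unfolding sum_distrib_left
proof (rule sum_mono)
  fix g assume "g \<in> {a..<b}"
  then show "charged g \<le> rate * w g" using charged_le_rate[of g] assms by (simp split: if_splits)
qed

lemma sum_charged_le_rate_minus:
  assumes "2 * n \<le> a" "b \<le> 3 * n"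
  shows "sum charged {a..<b} \<le> rate * sum w {a..<b} - 12/125 * real (b - a)"
proof -
  have "sum charged {a..<b} \<le> (\<Sum>g\<in>{a..<b}. rate * w g - 12/125)"
  proof (rule sum_mono)
    fix g assume "g \<in> {a..<b}"
    then show "charged g \<le> rate * w g - 12/125" using charged_le_rate[of g] assms by simp
  qed
  then show ?thesis by (simp add: sum_subtractf sum_distrib_left)
qed

lemma charged_le_if_ge_3n:
  assumes "3 * n \<le> g"
  shows "charged g \<le> rate * (3/16 + d / 4)"
  using charged_le_rate[of g] anti[OF assms] value_3n assms by simp

lemma critical_bag_charged_less:
  assumes critical_k: "k < n" "critical k" and filling: "2 * n \<le> a"
    and worth: "w k + w (n + k) + sum w {a..<b} < 3/4 + d"
  shows "charged k + charged (n + k) + sum charged {a..<b} < 4 - 12/125"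
proof -
  have "charged k + charged (n + k) = 4 - \<gamma>"
    using critical_k slot_sum by (simp add: charged_def weight_def)
  moreover have "sum w {a..<b} < 3/4 + d - 29/40" using worth critical_k(2)
    by (simp add: critical_def)
  ultimately show ?thesis using sum_charged_le_rate[OF filling, of b] gamma_ge d_le by simp
qed

lemma critical_bag_charged_le:
  assumes critical_k: "k < n" "critical k" and filling: "2 * n \<le> a" "a < b"
    and worth: "w k + w (n + k) + sum w {a..<b - 1} < 3/4 + d"
  shows "charged k + charged (n + k) + sum charged {a..<b} \<le> 4 - 12/125"
proof -
  have pair_charged: "charged k + charged (n + k) = 4 - \<gamma>"
    using critical_k slot_sum by (simp add: charged_def weight_def)
  show ?thesis
  proof (cases "b = Suc a")
    case True
    then show ?thesis
      using pair_charged gamma_ge d_le charged_le_gamma[OF filling(1)] charged_le_if_ge_3n[of a]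
      by (cases "a < 3 * n") simp_all
  next
    case False
    have "w (b - 1) \<le> w a" using filling(2) by (intro anti) simp
    also have "w a \<le> sum w {a..<b - 1}" using False filling(2)
      by (intro member_le_sum) (auto simp: nonneg)
    finally have "sum w {a..<b} \<le> 2 * sum w {a..<b - 1}"
      using filling(2) sum.atLeastLessThan_Suc[of a "b - 1" w] by simp
    also have "\<dots> \<le> 2 * (3/4 + d - 29/40)" using worth critical_k(2) by (simp add: critical_def)
    finally show ?thesis using sum_charged_le_rate[OF filling(1), of b] pair_charged gamma_ge d_le
      by simp
  qed
qed

lemma plain_pair_charged:
  assumes "k < n" "\<not> critical k"
  shows "charged k + charged (n + k) = 2 * \<gamma> \<or> charged k + charged (n + k) \<le>
    rate * (w k + w (n + k)) - 2 * (rate / 4 - 1) * (1 - 4 * d) + 16 * d / 3"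
proof -
  have plain_weight_cases: "plain_weight x = \<gamma> \<or>
    plain_weight x = rate * x - (rate / 4 - 1) * (1 - 4 * d)" for x
    by (simp add: plain_weight_def max_def)
  have plain_weight_le: "plain_weight (w g)
    \<le> rate * w g - (rate / 4 - 1) * (1 - 4 * d) + 16 * d / 3"
    if "g < 2 * n" for g
    using plain_weight_cases[of "w g"] gamma_le anti[OF less_imp_le[OF that]] tight d_nonneg by argo
  have "k < 2 * n" "n + k < 2 * n" using assms(1) by simp_all
  note pair_weight_le = plain_weight_le[OF this(1)] plain_weight_le[OF this(2)]
  have "charged k + charged (n + k) = plain_weight (w k) + plain_weight (w (n + k))"
    using assms by (simp add: charged_def weight_def)
  then show ?thesis
    using plain_weight_cases[of "w k"] plain_weight_cases[of "w (n + k)"] pair_weight_le by argo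
qed

lemma pair_bounds:
  assumes "k < n"
  shows "1/2 - 2 * d \<le> w k + w (n + k)" "w k + w (n + k) \<le> 7/8 + 5 * d / 2"
  using anti[of k "2 * n"] anti[of "n + k" "2 * n"] anti[of 0 k] anti[of n "n + k"] pair_less
    tight value_n assms
  by simp_all

lemma plain_bag_charged_less:
  assumes plain_k: "k < n" "\<not> critical k" and filling: "2 * n \<le> a"
    and worth: "w k + w (n + k) + sum w {a..<b} < 3/4 + d"
  shows "charged k + charged (n + k) + sum charged {a..<b} < 4 - 12/125"
  using plain_pair_charged[OF plain_k] pair_bounds[OF plain_k(1)]
    sum_charged_le_rate[OF filling, of b] worth gamma_le d_le
  by argo

lemma plain_bag_charged_le:
  assumes plain_k: "k < n" "\<not> critical k" and filling: "2 * n \<le> a" "a < b"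
    and worth: "w k + w (n + k) + sum w {a..<b - 1} < 3/4 + d"
  shows "charged k + charged (n + k) + sum charged {a..<b} \<le> 4 - 12/125"
proof -
  note pair_charged = plain_pair_charged[OF plain_k] pair_bounds[OF plain_k(1)]
  have split_last: "sum charged {a..<b} = sum charged {a..<b - 1} + charged (b - 1)"
    using filling(2) sum.atLeastLessThan_Suc[of a "b - 1" charged] by simp
  consider (one) "b = Suc a" "b \<le> 3 * n" | (two) "b = Suc (Suc a)" "b \<le> 3 * n"
    | (many) "Suc (Suc a) < b" "b \<le> 3 * n" | (small_last) "3 * n < b"
    using filling(2) by linarith
  then show ?thesis
  proof cases
    case one
    then have "w k + w (n + k) < 29/40" using worth plain_k(2) by (simp add: critical_def)
    then show ?thesis using pair_charged split_last gamma_le d_le charged_le_gamma[of a] one filling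
      by simp argo
  next
    case two
    have "charged a \<le> rate * w a - 12/125" "charged a \<le> \<gamma> - 12/125" "charged (Suc a) \<le> \<gamma> - 12/125"
      using charged_le_rate[of a] charged_le_gamma[of a] charged_le_gamma[of "Suc a"] filling two
      by auto
    then show ?thesis using pair_charged split_last gamma_le d_le worth two by simp argo
  next
    case many
    have "sum charged {a..<b - 1} \<le> rate * sum w {a..<b - 1} - 12/125 * real (b - 1 - a)"
      using sum_charged_le_rate_minus[of a "b - 1"] filling many by simp
    moreover have "2 \<le> real (b - 1 - a)" using many by simp
    moreover have "charged (b - 1) \<le> \<gamma> - 12/125" using charged_le_gamma[of "b - 1"] filling many
      by simp
    ultimately show ?thesis using pair_charged split_last gamma_le d_le worth by argo
  next
    case small_last
    then have "charged (b - 1) \<le> rate * (3/16 + d / 4)" by (intro charged_le_if_ge_3n) simp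
    then show ?thesis
      using pair_charged split_last gamma_le d_le worth
        sum_charged_le_rate[OF filling(1), of "b - 1"] by argo
  qed
qed

lemma pair_charged_le:
  assumes "k < n"
  shows "charged k + charged (n + k) \<le> 4 - 12/125"
proof (cases "critical k")
  case True
  then show ?thesis using assms slot_sum gamma_ge by (simp add: charged_def weight_def)
next
  case False
  then show ?thesis using plain_pair_charged[OF assms] pair_bounds[OF assms] gamma_le d_le by argo
qed

end

context irreducible_agent
begin

lemma no_stuck_shifted:
  assumes tight: "1/4 - d < w (2 * n)" and d_le: "d \<le> 3/956"
    and stuck: "stuck_bags n (2 * n) (shifted_pair n) m (3/4 + d) w c s"
  shows False
proof -
  interpret stuck_bags n "2 * n" "shifted_pair n" m "3/4 + d" w c s by (rule stuck)
  interpret stuck_agent n m w \<pi> J d "shifted_pair n" c s by unfold_locales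
  obtain U L where pair_bounds: "U + L \<le> 3/4 + d" "U \<le> 1/2 + 2 * d" "L \<le> 3/8 + d / 2"
    and critical_le: "\<And>k. critical k \<Longrightarrow> w k \<le> U \<and> w (n + k) \<le> L"
    using ex_critical_bounds[OF tight] by blast
  obtain \<alpha> \<beta> \<gamma> \<rho> where "slot_weights d U L \<alpha> \<beta> \<gamma> \<rho>"
    using ex_slot_weights[OF d_nonneg d_le pair_bounds] by blast
  then interpret slot_weights d U L \<alpha> \<beta> \<gamma> \<rho> .
  interpret tight_agent n m w \<pi> J d U L \<alpha> \<beta> \<gamma> \<rho>
    by unfold_locales (use tight d_le critical_le in auto)
  have sum_bag_shifted: "sum f (bag (shifted_pair n) c k)
    = f k + f (n + k) + sum f {c k..<c (Suc k)}"
    if "k < n" for f :: "nat \<Rightarrow> real" and k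
    using sum_bag_eq[OF that] sum_shifted_pair[OF that] by simp
  have before_last_shifted: "w k + w (n + k) + sum w {c k..<c (Suc k) - 1} < 3/4 + d"
    if "k < n" "c k < c (Suc k)" for k
    using before_last_less[OF that(2) nonneg] sum_bag[OF cutoff_mono cutoff_0 that(1)]
      sum_shifted_pair[OF that(1), of w] by simp
  have "sum charged {..<m} < n * (4 - 12/125)"
  proof (rule sum_goods_less)
    show "sum charged (bag (shifted_pair n) c k) \<le> 4 - 12/125" if "k < n" for k
      unfolding sum_bag_shifted[OF that]
      using critical_bag_charged_le[OF that _ cutoff_ge_l]
        plain_bag_charged_le[OF that _ cutoff_ge_l]
        before_last_shifted[OF that] pair_charged_le[OF that]
      by (cases "c k < c (Suc k)"; cases "critical k") simp_all
    show "sum charged (bag (shifted_pair n) c s) < 4 - 12/125"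
      unfolding sum_bag_shifted[OF stuck_less]
      using critical_bag_charged_less[OF stuck_less _ cutoff_ge_l]
        plain_bag_charged_less[OF stuck_less _ cutoff_ge_l]
        stuck_value sum_bag_shifted[OF stuck_less, of w] by (cases "critical s") simp_all
  qed
  then show False using sum_charged_goods_ge by simp
qed

end

section \<open>Irreducible instances\<close>

locale irreducible_instance =
  fixes N :: "'i set" and n m :: nat and w :: "'i \<Rightarrow> nat \<Rightarrow> real" and \<pi> :: "'i \<Rightarrow> nat \<Rightarrow> nat"
    and J :: "'i \<Rightarrow> nat set" and d :: real
  assumes finite_N: "finite N" and card_N: "card N = n"
    and agent: "i \<in> N \<Longrightarrow> irreducible_agent n m (w i) (\<pi> i) (J i) d"
begin

lemma pairs_available: "2 * n \<le> m"
proof (cases "N = {}")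
  case False
  then obtain i where "i \<in> N" by blast
  then show ?thesis using irreducible_agent.m_large[OF agent] by fastforce
qed (use card_N in simp)

definition tight_agents :: "'i set" where
  "tight_agents = {i \<in> N. 1/4 - d < w i (2 * n)}"

lemma tight_agents_subset: "tight_agents \<subseteq> N"
  by (auto simp: tight_agents_def)

lemma satisfiable_if_few_tight:
  assumes few: "4 * card tight_agents \<le> 3 * n" and d_small: "52 * d < 1"
  shows "satisfiable (3/4 + d) N w {..<m}"
proof -
  interpret initial_bags n "2 * n" "mirrored_pair n" by (rule initial_bags_mirrored)
  interpret bag_filling n "2 * n" "mirrored_pair n" m "3/4 + d" N w tight_agents
    using finite_N card_N pairs_available by unfold_locales
  show ?thesis
  proof (rule satisfiable_or_stuck)
    fix i c s S
    assume agent_i: "i \<in> N" and stuck: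
      "stuck_bags n (2 * n) (mirrored_pair n) m (3/4 + d) (w i) c s"
      and precedence: "S \<subseteq> {..<s}" "card S \<le> card (tight_agents \<inter> N)"
        "\<And>k. i \<in> tight_agents \<Longrightarrow> k < s \<Longrightarrow> k \<notin> S \<Longrightarrow> sum (w i) (bag (mirrored_pair n) c k) < 3/4 + d"
    interpret self: irreducible_agent n m "w i" "\<pi> i" "J i" d using agent_i by (rule agent)
    have few_S: "4 * card S \<le> 3 * n" using precedence(2) few tight_agents_subset
      by (simp add: Int_absorb2)
    show ?thesis
    proof (cases "i \<in> tight_agents")
      case True
      then have "1/4 - d < w i (2 * n)" by (simp add: tight_agents_def)
      then show ?thesis
        using self.no_stuck_mirrored_precedence[OF _ d_small stuck precedence(1) few_S
          precedence(3)[OF True]] by blast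
    next
      case False
      then have "w i (2 * n) \<le> 1/4 - d" using agent_i by (simp add: tight_agents_def)
      then show ?thesis using self.no_stuck_mirrored[OF _ _ stuck] d_small self.d_nonneg by simp
    qed
  qed
qed

lemma satisfiable_if_many_tight:
  assumes many: "3 * n < 4 * card tight_agents" and d_le: "d \<le> 3/956"
  shows "satisfiable (3/4 + d) N w {..<m}"
proof -
  interpret initial_bags n "2 * n" "shifted_pair n" by (rule initial_bags_shifted)
  interpret bag_filling n "2 * n" "shifted_pair n" m "3/4 + d" N w "N - tight_agents"
    using finite_N card_N pairs_available by unfold_locales
  show ?thesis
  proof (rule satisfiable_or_stuck)
    fix i c s S
    assume agent_i: "i \<in> N" and stuck: "stuck_bags n (2 * n) (shifted_pair n) m (3/4 + d) (w i) c s"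
      and precedence: "S \<subseteq> {..<s}" "card S \<le> card ((N - tight_agents) \<inter> N)"
        "\<And>k. i \<in> N - tight_agents \<Longrightarrow> k < s \<Longrightarrow> k \<notin> S \<Longrightarrow> sum (w i) (bag (shifted_pair n) c k) < 3/4 + d"
    interpret self: irreducible_agent n m "w i" "\<pi> i" "J i" d using agent_i by (rule agent)
    have "card (N - tight_agents) = n - card tight_agents"
      using tight_agents_subset finite_N card_N by (simp add: card_Diff_subset finite_subset)
    then have few_S: "4 * card S < n"
      using precedence(2) many card_mono[OF finite_N tight_agents_subset] card_N
      by (simp add: Int_absorb2)
    show ?thesis
    proof (cases "i \<in> tight_agents")
      case True
      then have "1/4 - d < w i (2 * n)" by (simp add: tight_agents_def)
      then show ?thesis using self.no_stuck_shifted[OF _ d_le stuck] by simp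
    next
      case False
      then have "i \<in> N - tight_agents" using agent_i by simp
      then show ?thesis
        using self.no_stuck_shifted_precedence[OF _ stuck precedence(1) few_S precedence(3)] d_le
        by simp
    qed
  qed
qed

lemma satisfiable_irreducible:
  assumes "d \<le> 3/956"
  shows "satisfiable (3/4 + d) N w {..<m}"
  using satisfiable_if_few_tight satisfiable_if_many_tight assms
  by (cases "4 * card tight_agents \<le> 3 * n") auto

end

section \<open>Reductions\<close>

text \<open>Giving away goods \<open>0\<close> and \<open>2n\<close> may cost another agent up to \<open>4\<delta>/3\<close> in one
  bundle: good \<open>2n\<close>, worth at most \<open>1/4 + \<delta>/3\<close>, is replaced by a chunk, the rest of the bundle
  of good \<open>0\<close>, worth at least \<open>1/4 - \<delta>\<close>. Counting every chunk with the nominal value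
  \<open>1/4 + \<delta>/3\<close> shows that these losses do not accumulate: with at most three chunks a bundle of
  nominal value 1 has lost at most \<open>4\<delta>\<close>, and four chunks alone are worth \<open>1 - 4\<delta>\<close>.

  The chunks of \<open>B\<close> are the sets \<open>{g \<in> B. \<kappa> g = k}\<close> with \<open>k \<in> K\<close>.\<close>

definition nominal_ge :: "real \<Rightarrow> ('g \<Rightarrow> real) \<Rightarrow> real \<Rightarrow> 'g set \<Rightarrow> bool" where
  "nominal_ge \<delta> u t B \<longleftrightarrow> (\<exists>(\<kappa> :: 'g \<Rightarrow> nat) K. finite K \<and>
     (\<forall>k\<in>K. 1/4 - \<delta> \<le> sum u {g \<in> B. \<kappa> g = k}) \<and>
     t \<le> card K * (1/4 + \<delta> / 3) + sum u {g \<in> B. \<kappa> g \<notin> K})"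

lemma nominal_geI:
  fixes \<kappa> :: "'g \<Rightarrow> nat"
  assumes "finite K" "\<And>k. k \<in> K \<Longrightarrow> 1/4 - \<delta> \<le> sum u {g \<in> B. \<kappa> g = k}"
    "t \<le> card K * (1/4 + \<delta> / 3) + sum u {g \<in> B. \<kappa> g \<notin> K}"
  shows "nominal_ge \<delta> u t B"
  using assms unfolding nominal_ge_def by blast

lemma nominal_geE:
  assumes "nominal_ge \<delta> u t B"
  obtains \<kappa> :: "'g \<Rightarrow> nat" and K where "finite K"
    "\<And>k. k \<in> K \<Longrightarrow> 1/4 - \<delta> \<le> sum u {g \<in> B. \<kappa> g = k}"
    "t \<le> card K * (1/4 + \<delta> / 3) + sum u {g \<in> B. \<kappa> g \<notin> K}"
  using assms unfolding nominal_ge_def by blast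

lemma nominal_ge_if_sum_ge: "t \<le> sum u B \<Longrightarrow> nominal_ge \<delta> u t B"
  by (rule nominal_geI[of "{}"]) auto

lemma sum_ge_if_nominal_ge_1:
  assumes "nominal_ge \<delta> u 1 B" "finite B" "0 \<le> \<delta>" "\<delta> \<le> 1/4" and nonneg: "\<And>g. g \<in> B \<Longrightarrow> 0 \<le> u g"
  shows "1 - 4 * \<delta> \<le> sum u B"
proof -
  obtain \<kappa> and K :: "nat set" where chunks: "finite K"
    "\<And>k. k \<in> K \<Longrightarrow> 1/4 - \<delta> \<le> sum u {g \<in> B. \<kappa> g = k}"
    "1 \<le> card K * (1/4 + \<delta> / 3) + sum u {g \<in> B. \<kappa> g \<notin> K}"
    using assms(1) by (rule nominal_geE) blast
  let ?C = "{g \<in> B. \<kappa> g \<in> K}"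
  have "{g \<in> ?C. \<kappa> g = k} = {g \<in> B. \<kappa> g = k}" if "k \<in> K" for k using that by auto
  then have sum_chunks: "card K * (1/4 - \<delta>) \<le> sum u ?C"
    using chunks(1,2) assms(2) by (intro card_mult_le_sum_fibres[of _ _ \<kappa>]) auto
  have "B = ?C \<union> {g \<in> B. \<kappa> g \<notin> K}" by auto
  then have sum_B: "sum u B = sum u ?C + sum u {g \<in> B. \<kappa> g \<notin> K}"
    using assms(2) sum.union_disjoint[of ?C "{g \<in> B. \<kappa> g \<notin> K}" u] by auto
  have sum_rest: "0 \<le> sum u {g \<in> B. \<kappa> g \<notin> K}" by (rule sum_nonneg) (use nonneg in auto)
  show ?thesis
  proof (cases "card K \<le> 3")
    case True
    then have "card K * (4 * \<delta> / 3) \<le> 3 * (4 * \<delta> / 3)" using assms(3)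
      by (intro mult_right_mono) auto
    then show ?thesis using chunks(3) sum_chunks sum_B by (simp add: algebra_simps)
  next
    case False
    then have "4 * (1/4 - \<delta>) \<le> card K * (1/4 - \<delta>)" using assms(4) by (intro mult_right_mono) auto
    then show ?thesis using sum_chunks sum_B sum_rest by simp
  qed
qed

lemma nominal_ge_reindex:
  assumes "nominal_ge \<delta> u t B" "bij_betw \<psi> B' B" "\<And>g. g \<in> B' \<Longrightarrow> u (\<psi> g) \<le> u' g"
  shows "nominal_ge \<delta> u' t B'"
proof -
  obtain \<kappa> and K :: "nat set" where chunks: "finite K"
    "\<And>k. k \<in> K \<Longrightarrow> 1/4 - \<delta> \<le> sum u {g \<in> B. \<kappa> g = k}"
    "t \<le> card K * (1/4 + \<delta> / 3) + sum u {g \<in> B. \<kappa> g \<notin> K}"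
    using assms(1) by (rule nominal_geE) blast
  have sum_le: "sum u {g \<in> B. P (\<kappa> g)} \<le> sum u' {g \<in> B'. P (\<kappa> (\<psi> g))}" for P
  proof -
    have "sum u {g \<in> B. P (\<kappa> g)} = (\<Sum>g\<in>{g \<in> B'. P (\<kappa> (\<psi> g))}. u (\<psi> g))"
      by (rule sum.reindex_bij_betw[OF bij_betw_Collect[OF assms(2)], symmetric]) simp
    also have "\<dots> \<le> sum u' {g \<in> B'. P (\<kappa> (\<psi> g))}" by (rule sum_mono) (use assms(3) in auto)
    finally show ?thesis .
  qed
  show ?thesis
  proof (rule nominal_geI[OF chunks(1), where \<kappa> = "\<kappa> \<circ> \<psi>"])
    show "1/4 - \<delta> \<le> sum u' {g \<in> B'. (\<kappa> \<circ> \<psi>) g = k}" if "k \<in> K" for k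
      using chunks(2)[OF that] sum_le[of "\<lambda>x. x = k"] by simp
    show "t \<le> card K * (1/4 + \<delta> / 3) + sum u' {g \<in> B'. (\<kappa> \<circ> \<psi>) g \<notin> K}"
      using chunks(3) sum_le[of "\<lambda>x. x \<notin> K"] by simp
  qed
qed

lemma nominal_ge_superset:
  assumes "nominal_ge \<delta> u t B" "B \<subseteq> B'" "finite B'" and nonneg: "\<And>g. g \<in> B' \<Longrightarrow> 0 \<le> u g"
  shows "nominal_ge \<delta> u t B'"
proof -
  obtain \<kappa> and K :: "nat set" where chunks: "finite K"
    "\<And>k. k \<in> K \<Longrightarrow> 1/4 - \<delta> \<le> sum u {g \<in> B. \<kappa> g = k}"
    "t \<le> card K * (1/4 + \<delta> / 3) + sum u {g \<in> B. \<kappa> g \<notin> K}"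
    using assms(1) by (rule nominal_geE) blast
  have sum_le: "sum u {g \<in> B. P (\<kappa> g)} \<le> sum u {g \<in> B'. P (\<kappa> g)}" for P
    by (rule sum_mono2) (use assms in auto)
  show ?thesis
  proof (rule nominal_geI[OF chunks(1), where \<kappa> = \<kappa>])
    show "1/4 - \<delta> \<le> sum u {g \<in> B'. \<kappa> g = k}" if "k \<in> K" for k
      using chunks(2)[OF that] sum_le[of "\<lambda>x. x = k"] by simp
    show "t \<le> card K * (1/4 + \<delta> / 3) + sum u {g \<in> B'. \<kappa> g \<notin> K}"
      using chunks(3) sum_le[of "\<lambda>x. x \<notin> K"] by simp
  qed
qed

lemma nominal_ge_remove:
  assumes "nominal_ge \<delta> u t B" "finite B" "g \<in> B" "u g \<le> 1/4 + \<delta> / 3"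
    and nonneg: "\<And>x. x \<in> B \<Longrightarrow> 0 \<le> u x"
  shows "nominal_ge \<delta> u (t - (1/4 + \<delta> / 3)) (B - {g})"
proof -
  obtain \<kappa> and K :: "nat set" where chunks: "finite K"
    "\<And>k. k \<in> K \<Longrightarrow> 1/4 - \<delta> \<le> sum u {g \<in> B. \<kappa> g = k}"
    "t \<le> card K * (1/4 + \<delta> / 3) + sum u {g \<in> B. \<kappa> g \<notin> K}"
    using assms(1) by (rule nominal_geE) blast
  show ?thesis
  proof (rule nominal_geI[where K = "K - {\<kappa> g}" and \<kappa> = \<kappa>])
    fix k assume other_chunk: "k \<in> K - {\<kappa> g}"
    then have "{x \<in> B - {g}. \<kappa> x = k} = {x \<in> B. \<kappa> x = k}" by auto
    then show "1/4 - \<delta> \<le> sum u {x \<in> B - {g}. \<kappa> x = k}" using chunks(2) other_chunk by simp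
  next
    show "t - (1/4 + \<delta> / 3) \<le> card (K - {\<kappa> g}) * (1/4 + \<delta> / 3) +
        sum u {x \<in> B - {g}. \<kappa> x \<notin> K - {\<kappa> g}}"
    proof (cases "\<kappa> g \<in> K")
      case True
      have "real (card K) = real (card (K - {\<kappa> g})) + 1"
        using True chunks(1) card_Suc_Diff1[of K "\<kappa> g"] by simp
      then have "card K * (1/4 + \<delta> / 3) = card (K - {\<kappa> g}) * (1/4 + \<delta> / 3) + (1/4 + \<delta> / 3)"
        by (simp only: distrib_right mult_1)
      moreover have "sum u {x \<in> B. \<kappa> x \<notin> K} \<le> sum u {x \<in> B - {g}. \<kappa> x \<notin> K - {\<kappa> g}}"
        by (rule sum_mono2) (use True assms(2) nonneg in auto)
      ultimately show ?thesis using chunks(3) by simp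
    next
      case False
      then have "sum u {x \<in> B. \<kappa> x \<notin> K} = u g + sum u ({x \<in> B. \<kappa> x \<notin> K} - {g})"
        using assms(2,3) by (intro sum.remove) auto
      moreover have "{x \<in> B. \<kappa> x \<notin> K} - {g} = {x \<in> B - {g}. \<kappa> x \<notin> K - {\<kappa> g}}" using False by auto
      ultimately show ?thesis using False chunks(3) assms(4) by simp
    qed
  qed (use chunks(1) in simp)
qed

lemma nominal_ge_add_chunk:
  assumes "nominal_ge \<delta> u t B" "finite B" "C \<inter> B = {}" "1/4 - \<delta> \<le> sum u C"
  shows "nominal_ge \<delta> u (t + (1/4 + \<delta> / 3)) (B \<union> C)"
proof -
  obtain \<kappa> and K :: "nat set" where chunks: "finite K"
    "\<And>k. k \<in> K \<Longrightarrow> 1/4 - \<delta> \<le> sum u {g \<in> B. \<kappa> g = k}"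
    "t \<le> card K * (1/4 + \<delta> / 3) + sum u {g \<in> B. \<kappa> g \<notin> K}"
    using assms(1) by (rule nominal_geE) blast
  obtain k0 where fresh: "k0 \<notin> K \<union> \<kappa> ` B"
    using ex_new_if_finite[of "K \<union> \<kappa> ` B"] chunks(1) assms(2) by auto
  define \<kappa>' where "\<kappa>' x = (if x \<in> C then k0 else \<kappa> x)" for x
  show ?thesis
  proof (rule nominal_geI[where K = "insert k0 K" and \<kappa> = \<kappa>'])
    fix k assume chunk: "k \<in> insert k0 K"
    have "{x \<in> B \<union> C. \<kappa>' x = k} = (if k = k0 then C else {x \<in> B. \<kappa> x = k})"
      using fresh chunk assms(3) by (auto simp: \<kappa>'_def)
    then show "1/4 - \<delta> \<le> sum u {x \<in> B \<union> C. \<kappa>' x = k}" using chunks(2) chunk assms(4) by auto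
  next
    have "{x \<in> B \<union> C. \<kappa>' x \<notin> insert k0 K} = {x \<in> B. \<kappa> x \<notin> K}"
      using fresh assms(3) by (auto simp: \<kappa>'_def)
    moreover have "real (card (insert k0 K)) = real (card K) + 1" using fresh chunks(1) by simp
    then have "card (insert k0 K) * (1/4 + \<delta> / 3) = card K * (1/4 + \<delta> / 3) + (1/4 + \<delta> / 3)"
      by (simp only: distrib_right mult_1)
    ultimately show "t + (1/4 + \<delta> / 3) \<le> card (insert k0 K) * (1/4 + \<delta> / 3) +
        sum u {x \<in> B \<union> C. \<kappa>' x \<notin> insert k0 K}"
      using chunks(3) by simp
  qed (use chunks(1) in simp)
qed

lemma sum_remainder_ge:
  assumes "nominal_ge \<delta> u 1 B" "finite B" "g \<in> B" "u g \<le> 3/4 + \<delta>" "0 \<le> \<delta>"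
    and nonneg: "\<And>x. x \<in> B \<Longrightarrow> 0 \<le> u x"
  shows "1/4 - \<delta> \<le> sum u (B - {g})"
proof -
  obtain \<kappa> and K :: "nat set" where chunks: "finite K"
    "\<And>k. k \<in> K \<Longrightarrow> 1/4 - \<delta> \<le> sum u {g \<in> B. \<kappa> g = k}"
    "1 \<le> card K * (1/4 + \<delta> / 3) + sum u {g \<in> B. \<kappa> g \<notin> K}"
    using assms(1) by (rule nominal_geE) blast
  have sum_le: "sum u C \<le> sum u (B - {g})" if "C \<subseteq> B - {g}" for C
    using that assms(2) nonneg by (intro sum_mono2) auto
  consider (no_chunk) "K = {}" | (own_chunk) "K = {\<kappa> g}" | (other_chunk) k where "k \<in> K" "k \<noteq> \<kappa> g"
    by blast
  then show ?thesis
  proof cases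
    case no_chunk
    then show ?thesis using chunks(3) sum.remove[OF assms(2,3), of u] assms(4) by simp
  next
    case own_chunk
    then have "3/4 - \<delta> / 3 \<le> sum u {x \<in> B. \<kappa> x \<notin> K}" using chunks(3) by simp
    also have "\<dots> \<le> sum u (B - {g})" by (rule sum_le) (use own_chunk in auto)
    finally show ?thesis using assms(5) by simp
  next
    case other_chunk
    have "1/4 - \<delta> \<le> sum u {x \<in> B. \<kappa> x = k}" by (rule chunks(2)[OF other_chunk(1)])
    also have "\<dots> \<le> sum u (B - {g})" by (rule sum_le) (use other_chunk in auto)
    finally show ?thesis .
  qed
qed

definition splits :: "real \<Rightarrow> ('g \<Rightarrow> real) \<Rightarrow> nat \<Rightarrow> 'g set \<Rightarrow> bool" where
  "splits \<delta> u n G \<longleftrightarrow> (\<exists>(\<pi> :: 'g \<Rightarrow> nat) J. finite J \<and> card J = n \<and>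
     (\<forall>j\<in>J. nominal_ge \<delta> u 1 {g \<in> G. \<pi> g = j}))"

lemma splitsI:
  fixes \<pi> :: "'g \<Rightarrow> nat"
  assumes "finite J" "card J = n" "\<And>j. j \<in> J \<Longrightarrow> nominal_ge \<delta> u 1 {g \<in> G. \<pi> g = j}"
  shows "splits \<delta> u n G"
  using assms unfolding splits_def by blast

lemma splitsE:
  assumes "splits \<delta> u n G"
  obtains \<pi> :: "'g \<Rightarrow> nat" and J where "finite J" "card J = n"
    "\<And>j. j \<in> J \<Longrightarrow> nominal_ge \<delta> u 1 {g \<in> G. \<pi> g = j}"
  using assms unfolding splits_def by blast

lemma splits_superset:
  assumes "splits \<delta> u n G" "G \<subseteq> G'" "finite G'" "\<And>g. g \<in> G' \<Longrightarrow> 0 \<le> u g"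
  shows "splits \<delta> u n G'"
proof -
  obtain \<pi> and J :: "nat set" where bundles: "finite J" "card J = n"
    "\<And>j. j \<in> J \<Longrightarrow> nominal_ge \<delta> u 1 {g \<in> G. \<pi> g = j}"
    using assms(1) by (rule splitsE) blast
  show ?thesis
    by (rule splitsI[OF bundles(1,2) nominal_ge_superset[OF bundles(3)]]) (use assms in auto)
qed

lemma splits_reindex:
  assumes "splits \<delta> u n G" "bij_betw \<psi> G' G" "\<And>g. g \<in> G' \<Longrightarrow> u (\<psi> g) \<le> u' g"
  shows "splits \<delta> u' n G'"
proof -
  obtain \<pi> and J :: "nat set" where bundles: "finite J" "card J = n"
    "\<And>j. j \<in> J \<Longrightarrow> nominal_ge \<delta> u 1 {g \<in> G. \<pi> g = j}"
    using assms(1) by (rule splitsE) blast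
  show ?thesis
  proof (rule splitsI[OF bundles(1,2), where \<pi> = "\<pi> \<circ> \<psi>"])
    show "nominal_ge \<delta> u' 1 {g \<in> G'. (\<pi> \<circ> \<psi>) g = j}" if "j \<in> J" for j
      by (rule nominal_ge_reindex[OF bundles(3)[OF that] bij_betw_Collect[OF assms(2)]])
        (use assms(3) in auto)
  qed
qed

lemma splits_cover:
  assumes "splits \<delta> u n G" "1 \<le> n" "finite G" "\<And>g. g \<in> G \<Longrightarrow> 0 \<le> u g"
  obtains \<pi> :: "'g \<Rightarrow> nat" and J where "finite J" "card J = n" "\<pi> ` G \<subseteq> J"
    "\<And>j. j \<in> J \<Longrightarrow> nominal_ge \<delta> u 1 {g \<in> G. \<pi> g = j}"
proof -
  obtain \<pi> and J :: "nat set" where bundles: "finite J" "card J = n"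
    "\<And>j. j \<in> J \<Longrightarrow> nominal_ge \<delta> u 1 {g \<in> G. \<pi> g = j}"
    using assms(1) by (rule splitsE) blast
  obtain j0 where default: "j0 \<in> J" using bundles(2) assms(2) by fastforce
  show ?thesis
  proof (rule that[OF bundles(1,2), where \<pi> = "\<lambda>g. if \<pi> g \<in> J then \<pi> g else j0"])
    show "nominal_ge \<delta> u 1 {g \<in> G. (if \<pi> g \<in> J then \<pi> g else j0) = j}" if "j \<in> J" for j
      by (rule nominal_ge_superset[OF bundles(3)[OF that]]) (use assms(3,4) that in auto)
  qed (use default in auto)
qed

lemma splits_remove_from_bundle:
  fixes \<pi> :: "'g \<Rightarrow> nat"
  assumes "finite J" "card J = n" "\<And>j. j \<in> J \<Longrightarrow> nominal_ge \<delta> u 1 {g \<in> G. \<pi> g = j}"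
    and bundle_j: "j \<in> J" "\<And>g. g \<in> T \<Longrightarrow> \<pi> g = j"
  shows "splits \<delta> u (n - 1) (G - T)"
proof (rule splitsI[where \<pi> = \<pi> and J = "J - {j}"])
  fix k assume other_label: "k \<in> J - {j}"
  then have "{g \<in> G - T. \<pi> g = k} = {g \<in> G. \<pi> g = k}" using bundle_j(2) by auto
  then show "nominal_ge \<delta> u 1 {g \<in> G - T. \<pi> g = k}" using assms(3) other_label by simp
qed (use assms(1,2) bundle_j(1) in auto)

lemma ex_bij_betw_exchange:
  fixes S T :: "'a :: linorder set"
  assumes "finite S" "finite T" "card S = card T" "S \<subseteq> A" "T \<subseteq> A"
    and earlier: "\<And>x y. x \<in> T - S \<Longrightarrow> y \<in> S \<Longrightarrow> x \<le> y"
  obtains \<psi> where "bij_betw \<psi> (A - S) (A - T)" "\<And>x. x \<in> A - S \<Longrightarrow> x \<le> \<psi> x"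
proof -
  have "card (T - S) = card (S - T)"
    using assms(1-3) by (simp add: card_Diff_subset_Int Int_commute)
  then obtain h where bij_h: "bij_betw h (T - S) (S - T)"
    using finite_same_card_bij[of "T - S" "S - T"] assms(1,2) by auto
  define \<psi> where "\<psi> x = (if x \<in> T - S then h x else x)" for x
  have "bij_betw \<psi> (T - S) (S - T)" using bij_h
    by (rule bij_betw_cong[THEN iffD2, rotated]) (simp add: \<psi>_def)
  moreover have "bij_betw \<psi> (A - S - T) (A - S - T)"
    by (rule bij_betw_cong[THEN iffD2, OF _ bij_betw_id]) (simp add: \<psi>_def)
  ultimately have "bij_betw \<psi> (T - S \<union> (A - S - T)) (S - T \<union> (A - S - T))"
    by (rule bij_betw_combine) auto
  moreover have "T - S \<union> (A - S - T) = A - S" "S - T \<union> (A - S - T) = A - T" using assms(4,5) by auto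
  ultimately have "bij_betw \<psi> (A - S) (A - T)" by simp
  moreover have "x \<le> \<psi> x" for x using bij_betwE[OF bij_h] earlier by (auto simp: \<psi>_def)
  ultimately show ?thesis using that by blast
qed

text \<open>By the pigeonhole principle some bundle contains \<open>j + 1\<close> of the first \<open>j * n + 1\<close> goods;
  exchanging them for the last \<open>j + 1\<close> of these goods does not harm the other bundles.\<close>

lemma splits_remove_block:
  fixes u :: "nat \<Rightarrow> real"
  assumes splits: "splits \<delta> u n {..<m}" and n_pos: "1 \<le> n" and block_available: "j * n < m"
    and "antimono u" "\<And>g. 0 \<le> u g"
  shows "splits \<delta> u (n - 1) ({..<m} - {j * (n - 1)..j * n})"
proof -
  obtain \<pi> and J :: "nat set" where bundles: "finite J" "card J = n" "\<pi> ` {..<m} \<subseteq> J"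
    "\<And>k. k \<in> J \<Longrightarrow> nominal_ge \<delta> u 1 {g \<in> {..<m}. \<pi> g = k}"
    by (rule splits_cover[OF splits n_pos finite_lessThan assms(5)]) (rule that)
  have "{..<m} \<inter> {..j * n} = {..j * n}" using block_available by auto
  then have "(\<Sum>g<m. of_bool (g \<in> {..j * n}) :: real) = j * n + 1"
    using sum_of_bool_eq[of "{..<m}" "\<lambda>g. g \<in> {..j * n}"] by (simp add: Int_def)
  then have "card J * real j < (\<Sum>g<m. of_bool (g \<in> {..j * n}))" using bundles(2)
    by (simp add: mult.commute)
  then obtain k where label: "k \<in> J"
    and "real j < (\<Sum>g\<in>{g \<in> {..<m}. \<pi> g = k}. of_bool (g \<in> {..j * n}))"
    by (rule pigeonhole_sum_fibres[OF finite_lessThan bundles(1,3)])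
  then have "Suc j \<le> card ({g \<in> {..<m}. \<pi> g = k} \<inter> {..j * n})" by (simp add: Int_def)
  then obtain T where removed: "T \<subseteq> {g \<in> {..<m}. \<pi> g = k} \<inter> {..j * n}" "card T = Suc j"
    by (meson obtain_subset_with_card_n)
  have "splits \<delta> u (n - 1) ({..<m} - T)"
    by (rule splits_remove_from_bundle[OF bundles(1,2,4) label]) (use removed(1) in auto)
  moreover obtain \<psi> where "bij_betw \<psi> ({..<m} - {j * (n - 1)..j * n}) ({..<m} - T)"
    "\<And>g. g \<in> {..<m} - {j * (n - 1)..j * n} \<Longrightarrow> g \<le> \<psi> g"
  proof (rule ex_bij_betw_exchange[of "{j * (n - 1)..j * n}" T "{..<m}"])
    show "card {j * (n - 1)..j * n} = card T" using card_block[OF n_pos] removed(2) by simp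
    show "finite T" using removed(1) by (rule finite_subset) auto
  qed (use removed(1) block_available in auto)
  ultimately show ?thesis using antimonoD[OF assms(4)] by (auto intro: splits_reindex)
qed

lemma splits_remove_pair:
  assumes splits: "splits \<delta> u n G" and n_pos: "1 \<le> n" and finite_G: "finite G"
    and delta_nonneg: "0 \<le> \<delta>"
    and good_p: "p \<in> G" "u p \<le> 3/4 + \<delta>" and good_q: "q \<in> G" "u q \<le> 1/4 + \<delta> / 3"
    and nonneg: "\<And>g. g \<in> G \<Longrightarrow> 0 \<le> u g"
  shows "splits \<delta> u (n - 1) (G - {p, q})"
proof -
  obtain \<pi> and J :: "nat set" where bundles: "finite J" "card J = n" "\<pi> ` G \<subseteq> J"
    "\<And>j. j \<in> J \<Longrightarrow> nominal_ge \<delta> u 1 {g \<in> G. \<pi> g = j}"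
    by (rule splits_cover[OF splits n_pos finite_G]) (erule nonneg, rule that)
  have label_p: "\<pi> p \<in> J" and label_q: "\<pi> q \<in> J" using bundles(3) good_p(1) good_q(1) by auto
  show ?thesis
  proof (cases "\<pi> p = \<pi> q")
    case True
    then show ?thesis by (intro splits_remove_from_bundle[OF bundles(1,2,4) label_p]) auto
  next
    case False
    define \<pi>' where "\<pi>' g = (if \<pi> g = \<pi> p then \<pi> q else \<pi> g)" for g
    show ?thesis
    proof (rule splitsI[where \<pi> = \<pi>' and J = "J - {\<pi> p}"])
      fix j assume other_label: "j \<in> J - {\<pi> p}"
      show "nominal_ge \<delta> u 1 {g \<in> G - {p, q}. \<pi>' g = j}"
      proof (cases "j = \<pi> q")
        case True
        let ?P = "{g \<in> G. \<pi> g = \<pi> p}" and ?Q = "{g \<in> G. \<pi> g = \<pi> q}"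
        have remainder: "1/4 - \<delta> \<le> sum u (?P - {p})"
          using good_p finite_G nonneg delta_nonneg
          by (intro sum_remainder_ge[OF bundles(4)[OF label_p]]) auto
        have disjoint: "(?P - {p}) \<inter> (?Q - {q}) = {}" using False by auto
        have "nominal_ge \<delta> u (1 - (1/4 + \<delta> / 3)) (?Q - {q})"
          using good_q finite_G nonneg by (intro nominal_ge_remove[OF bundles(4)[OF label_q]]) auto
        then have "nominal_ge \<delta> u 1 (?Q - {q} \<union> (?P - {p}))"
          using nominal_ge_add_chunk[OF _ _ disjoint remainder] finite_G by fastforce
        also have "?Q - {q} \<union> (?P - {p}) = {g \<in> G - {p, q}. \<pi>' g = j}"
          using True False by (auto simp: \<pi>'_def)
        finally show ?thesis .
      next
        case False
        then have "{g \<in> G - {p, q}. \<pi>' g = j} = {g \<in> G. \<pi> g = j}" using other_label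
          by (auto simp: \<pi>'_def)
        then show ?thesis using bundles(4) other_label by simp
      qed
    qed (use bundles(1,2) label_p in auto)
  qed
qed

lemma ex_unit_bundles:
  fixes u :: "'g \<Rightarrow> real"
  assumes splits: "splits \<delta> u n G" and "1 \<le> n" "finite G" and delta_bounds: "0 \<le> \<delta>" "\<delta> < 1/4"
    and nonneg: "\<And>g. g \<in> G \<Longrightarrow> 0 \<le> u g"
  shows "\<exists>f (\<pi> :: 'g \<Rightarrow> nat) J. finite J \<and> card J = n \<and> \<pi> ` G \<subseteq> J \<and>
    (\<forall>j\<in>J. sum f {g \<in> G. \<pi> g = j} = 1) \<and> (\<forall>g\<in>G. 0 \<le> f g \<and> f g \<le> u g / (1 - 4 * \<delta>))"
proof -
  obtain \<pi> and J :: "nat set" where bundles: "finite J" "card J = n" "\<pi> ` G \<subseteq> J"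
    "\<And>j. j \<in> J \<Longrightarrow> nominal_ge \<delta> u 1 {g \<in> G. \<pi> g = j}"
    by (rule splits_cover[OF assms(1-3)]) (erule nonneg, rule that)
  define worth where "worth j = sum u {g \<in> G. \<pi> g = j}" for j
  have worth_ge: "1 - 4 * \<delta> \<le> worth j" if "j \<in> J" for j
    unfolding worth_def using assms(3) delta_bounds nonneg
    by (intro sum_ge_if_nominal_ge_1[OF bundles(4)[OF that]]) auto
  have worth_pos: "0 < worth j" if "j \<in> J" for j using worth_ge[OF that] delta_bounds(2) by linarith
  have label: "\<pi> g \<in> J" if "g \<in> G" for g using bundles(3) that by blast
  define f where "f g = u g / worth (\<pi> g)" for g
  show ?thesis
  proof (intro exI conjI ballI)
    show "sum f {g \<in> G. \<pi> g = j} = 1" if "j \<in> J" for j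
    proof -
      have "sum f {g \<in> G. \<pi> g = j} = (\<Sum>g\<in>{g \<in> G. \<pi> g = j}. u g / worth j)"
        by (rule sum.cong) (auto simp: f_def)
      also have "\<dots> = 1" using worth_pos[OF that] by (simp add: worth_def flip: sum_divide_distrib)
      finally show ?thesis .
    qed
    show "0 \<le> f g" if "g \<in> G" for g
      using worth_pos[OF label[OF that]] nonneg[OF that] by (simp add: f_def)
    show "f g \<le> u g / (1 - 4 * \<delta>)" if "g \<in> G" for g
      unfolding f_def using worth_ge[OF label[OF that]] nonneg[OF that] delta_bounds(2)
      by (intro divide_left_mono) auto
  qed (fact bundles(1-3))+
qed

lemma ex_normalised_agent:
  fixes u :: "nat \<Rightarrow> real"
  assumes splits: "splits \<delta> u n {..<m}" and n_pos: "1 \<le> n" and delta_bounds: "0 \<le> \<delta>" "\<delta> < 1/4"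
    and decreasing: "antimono u" and nonneg: "\<And>g. 0 \<le> u g"
  obtains w \<pi> J where "normalised_agent n m w \<pi> J" "\<And>g. w g \<le> u g / (1 - 4 * \<delta>)"
proof -
  obtain f \<pi> and J :: "nat set" where bundles: "finite J" "card J = n" "\<pi> ` {..<m} \<subseteq> J"
    "\<forall>j\<in>J. sum f {g \<in> {..<m}. \<pi> g = j} = 1"
    and f_bounds: "\<forall>g\<in>{..<m}. 0 \<le> f g \<and> f g \<le> u g / (1 - 4 * \<delta>)"
    using ex_unit_bundles[OF splits n_pos finite_lessThan delta_bounds nonneg] by auto
  obtain e where sorting: "bij_betw e {..<m} {..<m}" "antimono_on {..<m} (f \<circ> e)"
    using ex_decreasing_enumeration[OF finite_lessThan, of m f] by auto
  have e_less: "e k < m" if "k < m" for k using bij_betwE[OF sorting(1)] that by auto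
  define w where "w k = (if k < m then f (e k) else 0)" for k
  show ?thesis
  proof (rule that)
    show "normalised_agent n m w (\<pi> \<circ> e) J"
    proof
      show "(\<pi> \<circ> e) ` {..<m} \<subseteq> J" using bundles(3) e_less by auto
      show "antimono w"
        using monotone_onD[OF sorting(2)] f_bounds e_less by (auto intro!: antimonoI simp: w_def)
      show "0 \<le> w k" for k using f_bounds e_less by (simp add: w_def)
      fix j assume label: "j \<in> J"
      have "sum w {k \<in> {..<m}. (\<pi> \<circ> e) k = j} = (\<Sum>k\<in>{k \<in> {..<m}. \<pi> (e k) = j}. f (e k))"
        by (rule sum.cong) (auto simp: w_def)
      also have "\<dots> = sum f {g \<in> {..<m}. \<pi> g = j}"
        by (rule sum.reindex_bij_betw[OF bij_betw_Collect[OF sorting(1)]]) simp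
      also have "\<dots> = 1" using bundles(4) label by blast
      finally show "sum w {k \<in> {..<m}. (\<pi> \<circ> e) k = j} = 1" .
    qed (use bundles in auto)
    have "antimono (\<lambda>g. u g / (1 - 4 * \<delta>))"
      using antimonoD[OF decreasing] delta_bounds(2) by (intro antimonoI divide_right_mono) auto
    then have "f (e k) \<le> u k / (1 - 4 * \<delta>)" if "k < m" for k
      using decreasing_rearrangement_le[OF sorting, of "\<lambda>g. u g / (1 - 4 * \<delta>)", OF _ _ that]
        f_bounds
      by blast
    then show "w k \<le> u k / (1 - 4 * \<delta>)" for k using nonneg[of k] delta_bounds(2)
      by (simp add: w_def)
  qed
qed

lemma ex_mono_enumeration_Diff:
  fixes S :: "nat set"
  assumes "S \<subseteq> {..<m}"
  obtains e :: "nat \<Rightarrow> nat" where "mono e" "bij_betw e {..<m - card S} ({..<m} - S)"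
proof -
  have card_Diff: "card ({..<m} - S) = m - card S" using assms
    by (simp add: card_Diff_subset finite_subset)
  obtain h where bij_h: "bij_betw h {..<m - card S} ({..<m} - S)" "strict_mono_on {..<m - card S} h"
    using ex_bij_betw_strict_mono_card[of "{..<m} - S"] unfolding card_Diff by auto
  define e where "e k = (if k < m - card S then h k else m)" for k
  show ?thesis
  proof
    show "mono e"
      using strict_mono_on_leD[OF bij_h(2)] bij_betwE[OF bij_h(1)]
      by (force intro!: monoI simp: e_def)
    show "bij_betw e {..<m - card S} ({..<m} - S)"
      using bij_h(1) by (rule bij_betw_cong[THEN iffD2, rotated]) (simp add: e_def)
  qed
qed

lemma ex_irreducible_agent:
  fixes u :: "nat \<Rightarrow> real"
  assumes splits: "splits \<delta> u n {..<m}" and n_pos: "1 \<le> n" and m_large: "3 * n < m"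
    and delta_bounds: "0 \<le> \<delta>" "\<delta> < 1/4"
    and u_props: "antimono u" "\<And>g. 0 \<le> u g"
    and block: "\<And>j. j \<le> 3 \<Longrightarrow> sum u {j * (n - 1)..j * n} < 3/4 + \<delta>"
    and pair: "u 0 + u (2 * n) < 3/4 + \<delta>"
  shows "\<exists>w \<pi> J. irreducible_agent n m w \<pi> J (4 * \<delta> / (1 - 4 * \<delta>)) \<and> (\<forall>g. w g \<le> u g / (1 - 4 * \<delta>))"
proof -
  obtain w \<pi> J where normalised: "normalised_agent n m w \<pi> J" "\<And>g. w g \<le> u g / (1 - 4 * \<delta>)"
    using ex_normalised_agent[OF splits n_pos delta_bounds u_props] by blast
  interpret normalised_agent n m w \<pi> J by (rule normalised(1))
  have threshold: "(3/4 + \<delta>) / (1 - 4 * \<delta>) = 3/4 + 4 * \<delta> / (1 - 4 * \<delta>)"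
    using delta_bounds(2) by (simp add: field_simps)
  have less_if_scaled: "x < 3/4 + 4 * \<delta> / (1 - 4 * \<delta>)"
    if "x \<le> y / (1 - 4 * \<delta>)" "y < 3/4 + \<delta>" for x y
    unfolding threshold[symmetric]
    using that divide_strict_right_mono[OF that(2), of "1 - 4 * \<delta>"] delta_bounds(2) by simp
  have "irreducible_agent n m w \<pi> J (4 * \<delta> / (1 - 4 * \<delta>))"
  proof
    show "sum w {j * (n - 1)..j * n} < 3/4 + 4 * \<delta> / (1 - 4 * \<delta>)" if "j \<le> 3" for j
    proof (rule less_if_scaled[OF _ block[OF that]])
      show "sum w {j * (n - 1)..j * n} \<le> sum u {j * (n - 1)..j * n} / (1 - 4 * \<delta>)"
        unfolding sum_divide_distrib by (rule sum_mono) (rule normalised(2))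
    qed
    show "w 0 + w (2 * n) < 3/4 + 4 * \<delta> / (1 - 4 * \<delta>)"
      by (rule less_if_scaled[OF _ pair])
        (use normalised(2)[of 0] normalised(2)[of "2 * n"] in \<open>simp add: add_divide_distrib\<close>)
  qed (use n_pos m_large delta_bounds in auto)
  with normalised(2) show ?thesis by blast
qed

lemma satisfiable_if_no_reduction:
  fixes u :: "'i \<Rightarrow> nat \<Rightarrow> real"
  assumes agents: "finite N" "card N = n" "1 \<le> n" and m_large: "3 * n < m"
    and delta_bounds: "0 \<le> \<delta>" "\<delta> \<le> 3/3836"
    and decreasing: "\<And>i. i \<in> N \<Longrightarrow> antimono (u i)" and nonneg: "\<And>i g. i \<in> N \<Longrightarrow> 0 \<le> u i g"
    and splits: "\<And>i. i \<in> N \<Longrightarrow> splits \<delta> (u i) n {..<m}"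
    and irreducible: "\<And>i S. i \<in> N \<Longrightarrow> S \<subseteq> {..<m} \<Longrightarrow> card S \<le> 4 \<Longrightarrow>
      (\<And>k. k \<in> N \<Longrightarrow> splits \<delta> (u k) (n - 1) ({..<m} - S)) \<Longrightarrow> sum (u i) S < 3/4 + \<delta>"
  shows "satisfiable (3/4 + \<delta>) N u {..<m}"
proof -
  have block: "sum (u i) {j * (n - 1)..j * n} < 3/4 + \<delta>"
    if agent_i: "i \<in> N" and block_number: "j \<le> 3" for i j
  proof (rule irreducible[OF agent_i])
    have "j * n \<le> 3 * n" using block_number by (rule mult_le_mono1)
    then have block_available: "j * n < m" using m_large by linarith
    then show "{j * (n - 1)..j * n} \<subseteq> {..<m}" by auto
    show "card {j * (n - 1)..j * n} \<le> 4" using card_block[OF agents(3)] block_number by simp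
    show "splits \<delta> (u k) (n - 1) ({..<m} - {j * (n - 1)..j * n})" if "k \<in> N" for k
      using splits_remove_block[OF splits[OF that] agents(3) block_available decreasing[OF that]
        nonneg[OF that]] .
  qed
  have value_0: "u i 0 \<le> 3/4 + \<delta>" if "i \<in> N" for i using block[OF that, of 0] by simp
  have value_2n: "u i (2 * n) \<le> 1/4 + \<delta> / 3" if "i \<in> N" for i
    using mult_le_sum_block[OF decreasing[OF that] agents(3), of 2] block[OF that, of 2] by simp
  have pair: "u i 0 + u i (2 * n) < 3/4 + \<delta>" if agent_i: "i \<in> N" for i
  proof -
    have "sum (u i) {0, 2 * n} < 3/4 + \<delta>"
    proof (rule irreducible[OF agent_i])
      show "splits \<delta> (u k) (n - 1) ({..<m} - {0, 2 * n})" if "k \<in> N" for k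
        using splits[OF that] agents(3) m_large delta_bounds value_0[OF that] value_2n[OF that]
          nonneg[OF that]
        by (intro splits_remove_pair) auto
    qed (use m_large in \<open>auto simp: card_insert_if\<close>)
    then show ?thesis using agents(3) by simp
  qed
  let ?d = "4 * \<delta> / (1 - 4 * \<delta>)"
  have "\<exists>w \<pi> J. irreducible_agent n m w \<pi> J ?d \<and> (\<forall>g. w g \<le> u i g / (1 - 4 * \<delta>))"
    if agent_i: "i \<in> N" for i
    by (rule ex_irreducible_agent[OF splits[OF agent_i] agents(3) _ delta_bounds(1) _
          decreasing[OF agent_i] nonneg[OF agent_i] block[OF agent_i] pair[OF agent_i]])
      (use m_large delta_bounds(2) in simp_all)
  then obtain w \<pi> J where agent: "\<And>i. i \<in> N \<Longrightarrow> irreducible_agent n m (w i) (\<pi> i) (J i) ?d"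
    and w_le: "\<And>i g. i \<in> N \<Longrightarrow> w i g \<le> u i g / (1 - 4 * \<delta>)" by metis
  interpret irreducible_instance N n m w \<pi> J ?d
    using agents(1,2) agent by (rule irreducible_instance.intro)
  have "?d \<le> 3/956" using delta_bounds(2) by (simp add: field_simps)
  then have "satisfiable (3/4 + ?d) N w {..<m}" by (rule satisfiable_irreducible)
  moreover have "3/4 + ?d = 1 / (1 - 4 * \<delta>) * (3/4 + \<delta>)" using delta_bounds(2)
    by (simp add: field_simps)
  ultimately have "satisfiable (1 / (1 - 4 * \<delta>) * (3/4 + \<delta>)) N w {..<m}" by simp
  then show ?thesis by (rule satisfiable_scale) (use w_le delta_bounds(2) in auto)
qed

lemma satisfiable_ordered:
  fixes u :: "'i \<Rightarrow> nat \<Rightarrow> real"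
  assumes delta_bounds: "0 \<le> \<delta>" "\<delta> \<le> 3/3836" and "finite N" "card N = n" "4 * n < m"
    and "\<And>i. i \<in> N \<Longrightarrow> antimono (u i)" "\<And>i g. i \<in> N \<Longrightarrow> 0 \<le> u i g"
    and "\<And>i. i \<in> N \<Longrightarrow> splits \<delta> (u i) n {..<m}"
  shows "satisfiable (3/4 + \<delta>) N u {..<m}"
  using assms(3-)
proof (induction n arbitrary: N m u)
  case 0
  then show ?case by (simp add: satisfiable_def disjoint_family_on_def)
next
  case (Suc n)
  note agents = Suc.prems(1,2) and m_large = Suc.prems(3) and decreasing = Suc.prems(4)
    and nonneg = Suc.prems(5)
  show ?case
  proof (cases "\<exists>i S. i \<in> N \<and> S \<subseteq> {..<m} \<and> card S \<le> 4 \<and> 3/4 + \<delta> \<le> sum (u i) S \<and>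
      (\<forall>k\<in>N. splits \<delta> (u k) n ({..<m} - S))")
    case True
    then obtain i S where agent_i: "i \<in> N"
      and worth_S: "S \<subseteq> {..<m}" "card S \<le> 4" "3/4 + \<delta> \<le> sum (u i) S"
      and splits_rest: "\<And>k. k \<in> N \<Longrightarrow> splits \<delta> (u k) n ({..<m} - S)" by blast
    obtain e where renumbering: "mono e" "bij_betw e {..<m - card S} ({..<m} - S)"
      using ex_mono_enumeration_Diff[OF worth_S(1)] by blast
    have "satisfiable (3/4 + \<delta>) (N - {i}) (\<lambda>k g. u k (e g)) {..<m - card S}"
    proof (rule Suc.IH)
      show "4 * n < m - card S" using m_large worth_S(2) by simp
      show "antimono (\<lambda>g. u k (e g))" if "k \<in> N - {i}" for k
        using antimonoD[OF decreasing] monoD[OF renumbering(1)] that by (auto intro: antimonoI)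
      show "splits \<delta> (\<lambda>g. u k (e g)) n {..<m - card S}" if "k \<in> N - {i}" for k
        using that by (intro splits_reindex[OF splits_rest renumbering(2)]) auto
    qed (use agents agent_i nonneg in auto)
    then have "satisfiable (3/4 + \<delta>) (N - {i}) u ({..<m} - S)"
      by (rule satisfiable_image) (use renumbering(2) in \<open>auto simp: bij_betw_def\<close>)
    then have "satisfiable (3/4 + \<delta>) (insert i (N - {i})) u {..<m}"
      using worth_S(1,3) by (rule satisfiable_insert) simp
    then show ?thesis using agent_i by (simp add: insert_absorb)
  next
    case False
    then have irreducible: "sum (u i) S < 3/4 + \<delta>"
      if "i \<in> N" "S \<subseteq> {..<m}" "card S \<le> 4" "\<And>k. k \<in> N \<Longrightarrow> splits \<delta> (u k) n ({..<m} - S)" for i S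
      using that by (meson not_le)
    show ?thesis
      by (rule satisfiable_if_no_reduction[OF agents _ _ delta_bounds decreasing nonneg
        Suc.prems(6)])
        (use m_large irreducible in auto)
  qed
qed

section \<open>Arbitrary instances\<close>

lemma satisfiable_if_splits:
  fixes v :: "'i \<Rightarrow> 'g \<Rightarrow> real"
  assumes delta_bounds: "0 \<le> \<delta>" "\<delta> \<le> 3/3836" and finite: "finite N" "finite M"
    and nonneg: "\<And>i g. i \<in> N \<Longrightarrow> g \<in> M \<Longrightarrow> 0 \<le> v i g"
    and splits: "\<And>i. i \<in> N \<Longrightarrow> splits \<delta> (v i) (card N) M"
  shows "satisfiable (3/4 + \<delta>) N v M"
proof -
  let ?c = "card M"
  have "\<exists>e. bij_betw e {..<?c} M \<and> antimono_on {..<?c} (v i \<circ> e)" for i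
    using ex_decreasing_enumeration[OF finite(2), of "v i"] by metis
  then obtain e where sorting: "\<And>i. bij_betw (e i) {..<?c} M" "\<And>i. antimono_on {..<?c} (v i \<circ> e i)"
    by metis
  define u where "u i k = (if k < ?c then v i (e i k) else 0)" for i k
  have u_nonneg: "0 \<le> u i k" if "i \<in> N" for i k
    using nonneg[OF that] bij_betwE[OF sorting(1), of i] by (simp add: u_def)
  define m where "m = ?c + 4 * card N + 1"
  have "satisfiable (3/4 + \<delta>) N u {..<m}"
  proof (rule satisfiable_ordered[OF delta_bounds finite(1) refl])
    show "antimono (u i)" if "i \<in> N" for i
    proof (rule antimonoI)
      fix a b :: nat assume "a \<le> b"
      then show "u i b \<le> u i a"
        using monotone_onD[OF sorting(2), of a b i] u_nonneg[OF that, of a]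
        by (simp add: u_def split: if_splits)
    qed
    show "splits \<delta> (u i) (card N) {..<m}" if "i \<in> N" for i
      by (rule splits_superset[OF splits_reindex[OF splits[OF that] sorting(1)]])
        (use u_nonneg that in \<open>auto simp: u_def m_def\<close>)
  qed (auto simp: m_def u_nonneg)
  then have "satisfiable (3/4 + \<delta>) N u ({..<m} \<inter> {..<?c})"
    by (rule satisfiable_drop_worthless) (auto simp: u_def)
  moreover have "{..<m} \<inter> {..<?c} = {..<?c}" by (auto simp: m_def)
  ultimately have "satisfiable (1 * (3/4 + \<delta>)) N u {..<?c}" by simp
  then have "satisfiable (3/4 + \<delta>) N (\<lambda>i. v i \<circ> e i) {..<?c}"
    by (rule satisfiable_scale) (auto simp: u_def)
  then show ?thesis using sorting by (rule satisfiable_unsort)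
qed

lemma finite_partitions:
  assumes "finite S"
  shows "finite (partitions d S)"
proof -
  have "partitions d S \<subseteq> {P. \<forall>j. (j \<in> {..<d} \<longrightarrow> P j \<in> Pow S) \<and> (j \<notin> {..<d} \<longrightarrow> P j = {})}"
    by (auto simp: partitions_def)
  moreover have "finite {P. \<forall>j. (j \<in> {..<d} \<longrightarrow> P j \<in> Pow S) \<and> (j \<notin> {..<d} \<longrightarrow> P j = {})}"
    using assms by (intro finite_set_of_finite_funs) auto
  ultimately show ?thesis by (rule finite_subset)
qed

lemma MMS_attained:
  assumes "finite S" "1 \<le> d"
  obtains P where "P \<in> partitions d S"
    "MMS d v S = Min ((\<lambda>j. additive_val v (P j)) ` {..<d})"
proof -
  let ?F = "\<lambda>P. Min ((\<lambda>j. additive_val v (P j)) ` {..<d})"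
  have "(\<lambda>j. if j = 0 then S else {}) \<in> partitions d S" using assms(2)
    by (auto simp: partitions_def)
  then have "MMS d v S \<in> ?F ` partitions d S"
    unfolding MMS_def using finite_partitions[OF assms(1), of d] by (intro Max_in) auto
  then show ?thesis using that by blast
qed

lemma MMS_nonneg:
  assumes "finite S" "1 \<le> d" "\<And>g. g \<in> S \<Longrightarrow> 0 \<le> v g"
  shows "0 \<le> MMS d v S"
proof -
  obtain P where optimal: "P \<in> partitions d S"
    "MMS d v S = Min ((\<lambda>j. additive_val v (P j)) ` {..<d})"
    using MMS_attained[OF assms(1,2)] by blast
  have "0 \<le> additive_val v (P j)" if "j < d" for j
    unfolding additive_val_def using optimal(1) assms(3) that
    by (intro sum_nonneg) (auto simp: partitions_def)
  then show ?thesis unfolding optimal(2) using assms(2)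
    by (subst Min_ge_iff) (auto simp: lessThan_empty_iff)
qed

lemma splits_MMS:
  assumes "finite S" "1 \<le> d" "k \<le> d" "0 < MMS d v S"
  shows "splits \<delta> (\<lambda>g. v g / MMS d v S) k S"
proof -
  obtain P where optimal: "P \<in> partitions d S"
    "MMS d v S = Min ((\<lambda>j. additive_val v (P j)) ` {..<d})"
    using MMS_attained[OF assms(1,2)] by blast
  have "\<forall>g\<in>S. \<exists>j<d. g \<in> P j" using optimal(1) by (auto simp: partitions_def)
  then obtain \<pi> where labels: "\<And>g. g \<in> S \<Longrightarrow> \<pi> g < d \<and> g \<in> P (\<pi> g)" by metis
  have fibre: "{g \<in> S. \<pi> g = j} = P j" if "j < d" for j
  proof
    show "P j \<subseteq> {g \<in> S. \<pi> g = j}" using optimal(1) labels that by (fastforce simp: partitions_def)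
  qed (use labels in auto)
  show ?thesis
  proof (rule splitsI[of "{..<k}"])
    fix j assume "j \<in> {..<k}"
    then have j_less: "j < d" using assms(3) by simp
    then have "MMS d v S \<le> (\<Sum>g\<in>P j. v g)" unfolding optimal(2) additive_val_def[symmetric]
      by (intro Min_le) auto
    then have "1 \<le> (\<Sum>g\<in>P j. v g / MMS d v S)" using assms(4) by (simp flip: sum_divide_distrib)
    then show "nominal_ge \<delta> (\<lambda>g. v g / MMS d v S) 1 {g \<in> S. \<pi> g = j}"
      unfolding fibre[OF j_less] by (rule nominal_ge_if_sum_ge)
  qed auto
qed

lemma ex_alpha_MMS_if_satisfiable:
  fixes n :: nat and M :: "'g set" and v :: "nat \<Rightarrow> 'g \<Rightarrow> real"
  assumes "satisfiable \<alpha> {i. i < n \<and> 0 < MMS n (v i) M} (\<lambda>i g. v i g / MMS n (v i) M) M"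
    and MMS_ge: "\<And>i. i < n \<Longrightarrow> 0 \<le> MMS n (v i) M"
  shows "\<exists>A. alpha_MMS \<alpha> n M v A"
proof -
  let ?N = "{i. i < n \<and> 0 < MMS n (v i) M}"
  obtain A where alloc: "disjoint_family_on A ?N" "\<And>i. i \<in> ?N \<Longrightarrow> A i \<subseteq> M"
    "\<And>i. i \<in> ?N \<Longrightarrow> \<alpha> \<le> (\<Sum>g\<in>A i. v i g / MMS n (v i) M)"
    using assms(1) by (rule satisfiableE) blast
  define A' where "A' i = (if i \<in> ?N then A i else {})" for i
  have "\<alpha> * MMS n (v i) M \<le> additive_val (v i) (A' i)" if "i < n" for i
  proof (cases "i \<in> ?N")
    case True
    then have "\<alpha> \<le> (\<Sum>g\<in>A i. v i g) / MMS n (v i) M" using alloc(3) by (simp add: sum_divide_distrib)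
    then show ?thesis using True by (simp add: A'_def additive_val_def pos_le_divide_eq)
  next
    case False
    then have "MMS n (v i) M = 0" using MMS_ge[OF that] that by simp
    then show ?thesis using False by (simp add: A'_def additive_val_def)
  qed
  moreover have "is_allocation n M A'"
    using alloc(1,2) by (auto simp: is_allocation_def disjoint_family_on_def A'_def)
  ultimately show ?thesis by (auto simp: alpha_MMS_def)
qed

theorem theorem46:
  fixes n :: nat and M :: "'g set" and v :: "nat \<Rightarrow> 'g \<Rightarrow> real" and \<alpha> :: real
  assumes "n \<ge> 1"
    and "finite M"
    and "\<And>i g. i < n \<Longrightarrow> g \<in> M \<Longrightarrow> v i g \<ge> 0"
    and "\<alpha> \<le> 3/4 + 3/3836"
  shows "\<exists>A. alpha_MMS \<alpha> n M v A"
proof (rule ex_alpha_MMS_if_satisfiable)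
  let ?N = "{i. i < n \<and> 0 < MMS n (v i) M}"
  have "card ?N \<le> n" using card_mono[of "{..<n}" ?N] by auto
  then have "splits (3/3836) (\<lambda>g. v i g / MMS n (v i) M) (card ?N) M" if "i \<in> ?N" for i
    using splits_MMS[OF assms(2,1)] that by simp
  then have "satisfiable (3/4 + 3/3836) ?N (\<lambda>i g. v i g / MMS n (v i) M) M"
    using assms(2,3) by (intro satisfiable_if_splits) auto
  then show "satisfiable \<alpha> ?N (\<lambda>i g. v i g / MMS n (v i) M) M"
    using assms(4) by (rule satisfiable_antimono)
  show "0 \<le> MMS n (v i) M" if "i < n" for i
    using assms(3)[OF that] by (rule MMS_nonneg[OF assms(2,1)])
qed

end
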